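(* Suppose $G$ is a Polish group with ample generic elements and $\pi:G\to H$ is a group homomorphism into a topological group $H$ with uniform Souslin number at most $2^{\aleph_0}$ (in particular, this holds if $H$ is separable). Then $\pi$ is continuous.
   Context: A Polish group $G$ has ample generic elements if for each finite $n\ge 1$ there is a comeager orbit for the diagonal conjugacy action of $G$ on $G^n$, $g\cdot(g_1,\dots,g_n)=(gg_1g^{-1},\dots,gg_ng^{-1})$. The uniform Souslin number of a topological group $H$ is the least cardinal $\kappa$ such that no nonempty open subset of $H$ has $\kappa$ many pairwise disjoint right translates; equivalently, the least $\kappa$ such that for no open neighborhood $V$ of $1_H$ are there $\kappa$ many pairwise disjoint right translates of $V$. Topological groups are not assumed Hausdorff. *)

theory Defs
  imports "HOL-Analysis.Analysis"
begin

unbundle cardinal_syntax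

text \<open>
  Groups are written additively because the library's class of topological groups,
  \<^class>\<open>topological_group_add\<close>, is; it requires neither commutativity nor any separation axiom.
  A Polish group is a type of sort \<open>{polish_space, topological_group_add}\<close>. The complete metric
  belonging to \<^class>\<open>polish_space\<close> is only some complete metric compatible with the topology; no
  invariance under the group operation is assumed.
\<close>

definition nowhere_dense_in :: "'a topology \<Rightarrow> 'a set \<Rightarrow> bool" where
  "nowhere_dense_in X N \<longleftrightarrow> N \<subseteq> topspace X \<and> X interior_of (X closure_of N) = {}"

definition meager_in :: "'a topology \<Rightarrow> 'a set \<Rightarrow> bool" where
  "meager_in X S \<longleftrightarrow> (\<exists>\<N>. countable \<N> \<and> (\<forall>N\<in>\<N>. nowhere_dense_in X N) \<and> S = \<Union>\<N>)"

definition comeager_in :: "'a topology \<Rightarrow> 'a set \<Rightarrow> bool" where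
  "comeager_in X S \<longleftrightarrow> S \<subseteq> topspace X \<and> meager_in X (topspace X - S)"

text \<open>\<open>G\<^sup>n\<close> consists of the extensional functions on \<open>{..<n}\<close>.\<close>

definition power_topology :: "nat \<Rightarrow> (nat \<Rightarrow> 'a::topological_space) topology" where
  "power_topology n = product_topology (\<lambda>_. euclidean) {..<n}"

definition diagonal_conjugation :: "nat \<Rightarrow> 'a::group_add \<Rightarrow> (nat \<Rightarrow> 'a) \<Rightarrow> (nat \<Rightarrow> 'a)" where
  "diagonal_conjugation n g x = (\<lambda>i\<in>{..<n}. g + x i - g)"

definition diagonal_orbit :: "nat \<Rightarrow> (nat \<Rightarrow> 'a::group_add) \<Rightarrow> (nat \<Rightarrow> 'a) set" where
  "diagonal_orbit n x = range (\<lambda>g. diagonal_conjugation n g x)"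

definition ample_generic_elements ::
    "'a::{polish_space, topological_group_add} itself \<Rightarrow> bool" where
  "ample_generic_elements _ \<longleftrightarrow>
     (\<forall>n\<ge>1. \<exists>x \<in> topspace (power_topology n :: (nat \<Rightarrow> 'a) topology).
        comeager_in (power_topology n) (diagonal_orbit n x))"

definition right_translates :: "'a::group_add set \<Rightarrow> 'a set set" where
  "right_translates V = range (\<lambda>h. (\<lambda>v. v + h) ` V)"

definition bounds_disjoint_translates ::
    "'a::topological_group_add itself \<Rightarrow> 'c rel \<Rightarrow> bool" where
  "bounds_disjoint_translates _ \<kappa> \<longleftrightarrow>
     \<not> (\<exists>V::'a set. open V \<and> V \<noteq> {} \<and>
          (\<exists>\<F> \<subseteq> right_translates V. disjoint \<F> \<and> |\<F>| =o \<kappa>))"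

text \<open>
  A HOL constant must have its cardinals on a fixed type. Cardinals on \<open>'a set\<close> suffice, since
  \<open>'a set\<close> has larger cardinality than the set of all translates; the two lemmas below show that the
  choice is well defined and that it is least even among cardinals on arbitrary types.
\<close>

definition uniform_Souslin_number :: "'a::topological_group_add itself \<Rightarrow> 'a set rel" where
  "uniform_Souslin_number T =
     (SOME \<kappa>. Card_order \<kappa> \<and> bounds_disjoint_translates T \<kappa> \<and>
        (\<forall>\<mu>::'a set rel. Card_order \<mu> \<and> bounds_disjoint_translates T \<mu> \<longrightarrow> \<kappa> \<le>o \<mu>))"

lemma bounds_disjoint_translates_card_set:
  "bounds_disjoint_translates (T :: 'a::topological_group_add itself) |UNIV :: 'a set set|"
proof -
  have False if "\<F> \<subseteq> right_translates V" "|\<F>| =o |UNIV :: 'a set set|" for V :: "'a set" and \<F>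
  proof -
    have "|\<F>| \<le>o |right_translates V|"
      using that(1) by (rule card_of_mono1)
    also have "|right_translates V| \<le>o |UNIV :: 'a set|"
      unfolding right_translates_def by (rule card_of_image)
    finally have "|\<F>| \<le>o |UNIV :: 'a set|" .
    moreover have "|UNIV :: 'a set| <o |UNIV :: 'a set set|"
      using card_of_Pow[of "UNIV :: 'a set"] by simp
    ultimately have "|\<F>| <o |UNIV :: 'a set set|"
      by (rule ordLeq_ordLess_trans)
    then show False
      using that(2) not_ordLess_ordIso by blast
  qed
  then show ?thesis
    unfolding bounds_disjoint_translates_def by blast
qed

lemma uniform_Souslin_number:
  fixes T :: "'a::topological_group_add itself"
  shows "Card_order (uniform_Souslin_number T)"
    and "bounds_disjoint_translates T (uniform_Souslin_number T)"
    and "Card_order (\<mu> :: 'a set rel) \<Longrightarrow> bounds_disjoint_translates T \<mu> \<Longrightarrow>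
           uniform_Souslin_number T \<le>o \<mu>"
proof -
  let ?R = "{\<kappa> :: 'a set rel. Card_order \<kappa> \<and> bounds_disjoint_translates T \<kappa>}"
  have "|UNIV :: 'a set set| \<in> ?R"
    by (simp add: bounds_disjoint_translates_card_set card_of_Card_order)
  then have "\<exists>\<kappa>\<in>?R. \<forall>\<mu>\<in>?R. \<kappa> \<le>o \<mu>"
    by (intro exists_minim_Card_order) auto
  then have "\<exists>\<kappa> :: 'a set rel. Card_order \<kappa> \<and> bounds_disjoint_translates T \<kappa> \<and>
        (\<forall>\<mu>::'a set rel. Card_order \<mu> \<and> bounds_disjoint_translates T \<mu> \<longrightarrow> \<kappa> \<le>o \<mu>)"
    by auto
  from someI_ex[OF this] show "Card_order (uniform_Souslin_number T)"
    and "bounds_disjoint_translates T (uniform_Souslin_number T)"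
    and "Card_order (\<mu> :: 'a set rel) \<Longrightarrow> bounds_disjoint_translates T \<mu> \<Longrightarrow>
           uniform_Souslin_number T \<le>o \<mu>"
    unfolding uniform_Souslin_number_def by blast+
qed

lemma uniform_Souslin_number_least:
  fixes T :: "'a::topological_group_add itself" and \<mu> :: "'c rel"
  assumes "Card_order \<mu>" and "bounds_disjoint_translates T \<mu>"
  shows "uniform_Souslin_number T \<le>o \<mu>"
proof (rule ccontr)
  let ?\<kappa> = "uniform_Souslin_number T"
  assume not_le: "\<not> ?\<kappa> \<le>o \<mu>"
  have wo: "Well_order \<mu>" "Well_order ?\<kappa>"
    using assms(1) uniform_Souslin_number(1)[of T] by (auto simp: card_order_on_well_order_on)
  then have "\<mu> <o ?\<kappa>"
    using not_le not_ordLeq_iff_ordLess by blast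
  then have "|Field \<mu>| \<le>o |Field ?\<kappa>|"
    using card_of_mono2 ordLess_imp_ordLeq by blast
  then obtain f where f: "inj_on f (Field \<mu>)" "f ` Field \<mu> \<subseteq> Field ?\<kappa>"
    using card_of_ordLeq[of "Field \<mu>" "Field ?\<kappa>"] by blast
  have "|Field \<mu>| =o |f ` Field \<mu>|"
    using f(1) card_of_ordIsoI inj_on_imp_bij_betw by blast
  then have eq: "|f ` Field \<mu>| =o \<mu>"
    using card_of_Field_ordIso[OF assms(1)] ordIso_symmetric ordIso_transitive by blast
  then have "bounds_disjoint_translates T |f ` Field \<mu>|"
    using assms(2) unfolding bounds_disjoint_translates_def by (meson ordIso_transitive)
  then have "?\<kappa> \<le>o |f ` Field \<mu>|"
    using uniform_Souslin_number(3) card_of_Card_order by blast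
  then show False
    using eq not_le ordLeq_ordIso_trans by blast
qed

end

theory Submission
  imports Defs "HOL-Library.Countable_Set_Type"
begin

text \<open>
  Let \<open>\<pi> : G \<rightarrow> H\<close> be as in the theorem and \<open>W\<close> a neighbourhood of \<open>0\<close> in \<open>H\<close>. The goal is a
  neighbourhood of \<open>0\<close> in \<open>G\<close> that \<open>\<pi>\<close> maps into \<open>W\<close>. By Pettis's argument it is enough that, for a
  symmetric \<open>V\<close> with \<open>V + V \<subseteq> W\<close>, the set \<open>\<pi>\<^sup>-\<^sup>1(V)\<close> is comeager in some nonempty open set: then the
  difference set of \<open>\<pi>\<^sup>-\<^sup>1(V)\<close> is a neighbourhood of \<open>0\<close>.

  The bound on the uniform Souslin number enters in one way only. Whenever \<open>t\<close> is a family of elements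
  of \<open>H\<close> indexed by the Cantor space \<open>2\<^sup>\<nat>\<close> and \<open>V\<close> is a neighbourhood of \<open>0\<close>, two translates \<open>V + t a\<close> and \<open>V + t b\<close> with \<open>a \<noteq> b\<close> meet
  (\<open>perfect_family_translates_meet\<close>), so that \<open>t a - t b\<close> is in \<open>- V + V\<close>. Hence an assumption on preimages of
  neighbourhoods is refuted by a family of elements of \<open>G\<close>, indexed by \<open>2\<^sup>\<nat>\<close>, no two of which can have
  images that are close. Two such families are built, both as limits along the binary tree.

  If \<open>\<pi>\<^sup>-\<^sup>1(W)\<close> were meager, then by Mycielski's theorem there would be a family \<open>h\<close> none of whose
  differences \<open>h a - h b\<close> is in \<open>\<pi>\<^sup>-\<^sup>1(W)\<close> (\<open>perfect_family_avoiding_meager_differences\<close>). So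
  preimages of neighbourhoods are nonmeager.

  If \<open>\<pi>\<^sup>-\<^sup>1(W)\<close> were not comeager in any nonempty open set, then its complement \<open>B\<close> would be nonmeager in
  every nonempty open set. Put \<open>A = \<pi>\<^sup>-\<^sup>1(W\<^sub>3)\<close> with \<open>W\<^sub>3\<close> symmetric and so small that the sum of three of its elements is in
  \<open>W\<close>. Ample generics give a family \<open>h\<close> such that for all \<open>a \<noteq> b\<close>, in the right order, conjugation by
  \<open>- h b + h a\<close> carries some element of \<open>A\<close> into \<open>B\<close> (\<open>perfect_family_conjugating\<close>). But for
  some \<open>a \<noteq> b\<close> the element \<open>- h b + h a\<close> is itself in \<open>A\<close>, and then conjugation by it maps \<open>A\<close> into
  \<open>\<pi>\<^sup>-\<^sup>1(W)\<close>, which is disjoint from \<open>B\<close>.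

  In the construction of the second family, a node of the tree at level \<open>n\<close> carries a generic
  \<open>n\<close>-tuple. It branches by adding to this tuple an element \<open>y\<close> of \<open>A\<close> on one side and an element
  \<open>y'\<close> of \<open>B\<close> on the other, where \<open>y\<close> is the conjugate of \<open>y'\<close> by an element close to \<open>0\<close> that fixes the
  tuple. To find \<open>y\<close> and \<open>y'\<close> one needs two facts: almost every \<open>y\<close> extends a generic tuple to a generic
  tuple, by the Kuratowski-Ulam theorem (\<open>comeager_generic_extensions\<close>), and the orbit maps of
  the stabilizer of the tuple are open, by Effros's theorem (\<open>orbit_map_open\<close>).
\<close>

section \<open>Meager sets\<close>

lemma meager_in_subset: "meager_in X S \<Longrightarrow> T \<subseteq> S \<Longrightarrow> meager_in X T"
proof -
  assume "meager_in X S" "T \<subseteq> S"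
  then obtain \<N> where N: "countable \<N>" "\<And>N. N \<in> \<N> \<Longrightarrow> nowhere_dense_in X N" "S = \<Union>\<N>"
    unfolding meager_in_def by blast
  have "nowhere_dense_in X (N \<inter> T)" if "N \<in> \<N>" for N
  proof -
    have "X interior_of (X closure_of (N \<inter> T)) \<subseteq> X interior_of (X closure_of N)"
      by (intro interior_of_mono closure_of_mono) auto
    then show ?thesis
      using N(2)[OF that] unfolding nowhere_dense_in_def by blast
  qed
  moreover have "T = \<Union>((\<lambda>N. N \<inter> T) ` \<N>)"
    using N(3) \<open>T \<subseteq> S\<close> by auto
  ultimately show ?thesis
    unfolding meager_in_def using N(1) by (intro exI[of _ "(\<lambda>N. N \<inter> T) ` \<N>"]) auto
qed

lemma nowhere_dense_imp_meager_in: "nowhere_dense_in X N \<Longrightarrow> meager_in X N"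
  unfolding meager_in_def by (intro exI[of _ "{N}"]) auto

lemma meager_in_UN:
  assumes "countable I" "\<And>i. i \<in> I \<Longrightarrow> meager_in X (S i)"
  shows "meager_in X (\<Union>i\<in>I. S i)"
proof -
  obtain \<N> where N: "\<And>i. i \<in> I \<Longrightarrow> countable (\<N> i) \<and> (\<forall>N\<in>\<N> i. nowhere_dense_in X N) \<and> S i = \<Union>(\<N> i)"
    using assms(2) unfolding meager_in_def by metis
  show ?thesis
    unfolding meager_in_def using N assms(1) by (intro exI[of _ "\<Union>i\<in>I. \<N> i"]) auto
qed

lemma meager_in_Un: "meager_in X S \<Longrightarrow> meager_in X T \<Longrightarrow> meager_in X (S \<union> T)"
  using meager_in_UN[of "UNIV :: bool set" X "\<lambda>b. if b then S else T"]
  by (auto simp: UNIV_bool Un_commute)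

lemma meager_in_homeomorphic_image:
  assumes f: "homeomorphic_map X Y f" and "meager_in X S"
  shows "meager_in Y (f ` S)"
proof -
  obtain \<N> where N: "countable \<N>" "\<And>N. N \<in> \<N> \<Longrightarrow> nowhere_dense_in X N" "S = \<Union>\<N>"
    using assms(2) unfolding meager_in_def by blast
  have "nowhere_dense_in Y (f ` N)" if "N \<in> \<N>" for N
  proof -
    have "N \<subseteq> topspace X" "X interior_of (X closure_of N) = {}"
      using N(2)[OF that] by (auto simp: nowhere_dense_in_def)
    then show ?thesis
      unfolding nowhere_dense_in_def
      using homeomorphic_map_closure_of[OF f, of N] closure_of_subset_topspace[of X N]
        homeomorphic_map_interior_of[OF f, of "X closure_of N"] homeomorphic_imp_surjective_map[OF f]
      by (simp, metis image_mono)
  qed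
  then show ?thesis
    unfolding meager_in_def using N by (intro exI[of _ "(`) f ` \<N>"]) auto
qed

text \<open>
  Replacing nowhere dense sets by their closures; an enumeration by \<open>nat\<close> is possible because the
  empty set can be added to the cover.
\<close>

lemma meager_in_closed_cover:
  assumes "meager_in X S"
  shows "\<exists>F :: nat \<Rightarrow> _. (\<forall>n. closedin X (F n) \<and> X interior_of F n = {}) \<and> S \<subseteq> (\<Union>n. F n)"
proof -
  obtain \<N> where N: "countable \<N>" "\<And>N. N \<in> \<N> \<Longrightarrow> nowhere_dense_in X N" "S = \<Union>\<N>"
    using assms unfolding meager_in_def by blast
  let ?N = "from_nat_into (insert {} \<N>)"
  have r: "range ?N = insert {} \<N>"
    using N(1) by (intro range_from_nat_into) auto
  have nd: "nowhere_dense_in X (?N n)" for n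
  proof -
    have "?N n \<in> insert {} \<N>"
      using r by blast
    then show ?thesis
      using N(2) by (auto simp: nowhere_dense_in_def)
  qed
  have "S \<subseteq> (\<Union>n. X closure_of (?N n))"
  proof
    fix x assume "x \<in> S"
    then obtain N where "N \<in> \<N>" "x \<in> N" using N(3) by blast
    then obtain n where "N = ?N n" using r by (metis insertCI rangeE)
    then have "x \<in> X closure_of (?N n)"
      using \<open>x \<in> N\<close> nd[of n] closure_of_subset unfolding nowhere_dense_in_def by blast
    then show "x \<in> (\<Union>n. X closure_of (?N n))" by blast
  qed
  then show ?thesis
    using nd unfolding nowhere_dense_in_def
    by (intro exI[of _ "\<lambda>n. X closure_of (?N n)"]) auto
qed

lemma nonempty_open_not_meager_in:
  assumes "completely_metrizable_space X" "openin X U" "U \<noteq> {}"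
  shows "\<not> meager_in X U"
proof
  assume "meager_in X U"
  then obtain F :: "nat \<Rightarrow> 'a set"
    where F: "\<forall>n. closedin X (F n) \<and> X interior_of F n = {}" "U \<subseteq> (\<Union>n. F n)"
    using meager_in_closed_cover by metis
  have "X interior_of \<Union>(range F) = {}"
    using assms(1) F(1) by (intro Baire_category_alt) auto
  then show False
    using assms(2,3) F(2) interior_of_maximal by blast
qed

section \<open>Topological groups and limits\<close>

lemma homeomorphic_map_translations:
  fixes a b :: "'g::topological_group_add"
  shows "homeomorphic_map euclidean euclidean (\<lambda>x. a + x + b)"
    and "homeomorphic_map euclidean euclidean (\<lambda>x. a - x + b)"
proof -
  have "homeomorphic_maps euclidean euclidean (\<lambda>x. a + x + b) (\<lambda>x. - a + x - b)"
    by (auto simp: homeomorphic_maps_def add.assoc diff_conv_add_uminus minus_add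
        simp del: add_uminus_conv_diff intro!: continuous_intros)
  then show "homeomorphic_map euclidean euclidean (\<lambda>x. a + x + b)"
    by (rule homeomorphic_maps_map[THEN iffD1, THEN conjunct1])
  have "homeomorphic_maps euclidean euclidean (\<lambda>x. a - x + b) (\<lambda>x. b - x + a)"
    by (auto simp: homeomorphic_maps_def add.assoc diff_conv_add_uminus minus_add
        simp del: add_uminus_conv_diff intro!: continuous_intros)
  then show "homeomorphic_map euclidean euclidean (\<lambda>x. a - x + b)"
    by (rule homeomorphic_maps_map[THEN iffD1, THEN conjunct1])
qed

lemma symmetric_halving:
  fixes W :: "'g::topological_group_add set"
  assumes "open W" "0 \<in> W"
  obtains V where "open V" "0 \<in> V" "\<And>x. x \<in> V \<Longrightarrow> - x \<in> V" "\<And>x y. x \<in> V \<Longrightarrow> y \<in> V \<Longrightarrow> x + y \<in> W"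
proof -
  have "((\<lambda>p. fst p + snd p) \<longlongrightarrow> 0 + (0::'g)) (nhds 0 \<times>\<^sub>F nhds 0)"
    by (rule tendsto_add_Pair)
  then have "\<forall>\<^sub>F p in nhds 0 \<times>\<^sub>F nhds (0::'g). fst p + snd p \<in> W"
    using assms by (auto simp: tendsto_def)
  then obtain P Q where PQ: "\<forall>\<^sub>F x in nhds 0. P x" "\<forall>\<^sub>F x in nhds (0::'g). Q x"
    "\<And>x y. P x \<Longrightarrow> Q y \<Longrightarrow> x + y \<in> W"
    unfolding eventually_prod_filter by auto
  then obtain S T where ST: "open S" "0 \<in> S" "\<And>x. x \<in> S \<Longrightarrow> P x" "open T" "0 \<in> T" "\<And>x. x \<in> T \<Longrightarrow> Q x"
    unfolding eventually_nhds by blast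
  define V where "V = (S \<inter> T) \<inter> uminus -` (S \<inter> T)"
  have "open V"
    unfolding V_def using ST by (intro open_Int open_vimage continuous_intros) auto
  then show ?thesis
    using that[of V] ST PQ(3) by (auto simp: V_def)
qed

definition conjugate :: "'g::group_add \<Rightarrow> 'g \<Rightarrow> 'g" where
  "conjugate g y = g + y - g"

lemma conjugate_0 [simp]: "conjugate 0 y = y"
  by (simp add: conjugate_def)

lemma conjugate_add: "conjugate (g + h) y = conjugate g (conjugate h y)"
  by (simp add: conjugate_def add.assoc diff_conv_add_uminus minus_add del: add_uminus_conv_diff)

lemma conjugate_minus_cancel [simp]:
  "conjugate (- g) (conjugate g y) = y" "conjugate g (conjugate (- g) y) = y"
  by (simp_all flip: conjugate_add)

lemma homeomorphic_map_conjugate: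
  "homeomorphic_map euclidean euclidean (conjugate (g :: 'g::topological_group_add))"
  using homeomorphic_map_translations(1)[of g "- g"] by (simp add: conjugate_def[abs_def])

lemma meager_in_conjugate_image:
  fixes S :: "'g::topological_group_add set"
  shows "meager_in euclidean S \<Longrightarrow> meager_in euclidean (conjugate g ` S)"
  by (rule meager_in_homeomorphic_image[OF homeomorphic_map_conjugate])

text \<open>
  All limits along branches of trees, and in the back-and-forth argument for orbit maps, are taken in
  the given complete metric. This metric need not be invariant, so each construction has to make
  its steps small after the point reached so far is known.
\<close>

lemma geometric_steps_converge:
  fixes X :: "nat \<Rightarrow> 'a::complete_space"
  assumes "\<And>n. dist (X n) (X (Suc n)) \<le> r * (1/2) ^ Suc n"
  shows "\<exists>l. X \<longlonglongrightarrow> l \<and> dist (X 0) l \<le> r"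
proof -
  have steps: "dist (X m) (X (m + d)) \<le> r * (1/2)^m" for m d
  proof (induction d arbitrary: m)
    case 0
    have "0 \<le> r * (1/2) ^ Suc m"
      using assms[of m] order_trans zero_le_dist by blast
    then show ?case by simp
  next
    case (Suc d)
    have "dist (X m) (X (m + Suc d)) \<le> dist (X m) (X (Suc m)) + dist (X (Suc m)) (X (Suc m + d))"
      using dist_triangle by simp
    also have "\<dots> \<le> r * (1/2) ^ Suc m + r * (1/2) ^ Suc m"
      by (intro add_mono assms Suc.IH)
    finally show ?case by simp
  qed
  have "(\<lambda>m. r * (1/2)^m) \<longlonglongrightarrow> r * 0"
    by (intro tendsto_intros LIMSEQ_power_zero) simp
  then have "\<exists>M. \<forall>m\<ge>M. r * (1/2)^m < e" if "e > 0" for e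
    using order_tendstoD(2)[of "\<lambda>m. r * (1/2)^m" "r * 0" sequentially e] that
    by (simp add: eventually_sequentially)
  then have "Cauchy X"
    unfolding Cauchy_altdef by (metis le_add_diff_inverse le_less_trans less_imp_le steps order_refl)
  then obtain l where l: "X \<longlonglongrightarrow> l"
    using Cauchy_convergent convergent_def by blast
  have "(\<lambda>n. dist (X 0) (X n)) \<longlonglongrightarrow> dist (X 0) l"
    by (intro tendsto_intros l)
  then have "dist (X 0) l \<le> r"
    by (rule LIMSEQ_le_const2) (use steps[of 0] in auto)
  with l show ?thesis by blast
qed

section \<open>A perfect family avoiding a meager set of differences\<close>

text \<open>
  For fixed \<open>p\<close> and \<open>q\<close>, the \<open>f\<close> with \<open>p + f - q \<in> M\<close> or \<open>p - f - q \<in> M\<close> form a meager set, being a union of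
  two homeomorphic images of \<open>M\<close>; only finitely many pairs occur.
\<close>

lemma meager_in_avoiding_differences_step:
  fixes M :: "'g::{polish_space, topological_group_add} set"
  assumes "meager_in euclidean M" "finite R" "0 < r"
  obtains f where "dist 0 f < r"
    "\<And>p q. p \<in> R \<Longrightarrow> q \<in> R \<Longrightarrow> p + f - q \<notin> M \<and> p - f - q \<notin> M"
proof -
  let ?B = "\<Union>(p, q)\<in>R \<times> R. (\<lambda>m. - p + m + q) ` M \<union> (\<lambda>m. - q - m + p) ` M"
  have "meager_in euclidean ?B"
    using assms(1,2)
    by (auto intro!: meager_in_UN meager_in_Un meager_in_homeomorphic_image
        homeomorphic_map_translations intro: countable_finite)
  moreover have "\<not> meager_in euclidean (ball (0::'g) r)"
    using assms(3) by (intro nonempty_open_not_meager_in completely_metrizable_space_euclidean) auto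
  ultimately obtain f where f: "f \<in> ball 0 r" "f \<notin> ?B"
    using meager_in_subset by blast
  show thesis
  proof (rule that[of f])
    show "dist 0 f < r" using f(1) by simp
    fix p q assume pq: "p \<in> R" "q \<in> R"
    have "f = - p + (p + f - q) + q" "f = - q - (p - f - q) + p"
      by (simp_all add: add.assoc diff_conv_add_uminus minus_add del: add_uminus_conv_diff)
    then show "p + f - q \<notin> M \<and> p - f - q \<notin> M"
      using f(2) pq by blast
  qed
qed

lemma separate_finite_set_from_closed_differences:
  fixes N :: "'g::{metric_space, topological_group_add} set"
  assumes "finite R" "closed N" "\<And>p q. p \<in> R \<Longrightarrow> q \<in> R \<Longrightarrow> p \<noteq> q \<Longrightarrow> p - q \<notin> N"
  shows "\<exists>d>0. \<forall>p\<in>R. \<forall>q\<in>R. p \<noteq> q \<longrightarrow>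
    (\<forall>x y. dist 0 x < d \<longrightarrow> dist 0 y < d \<longrightarrow> (p + x) - (q + y) \<notin> N)"
proof -
  have "\<forall>\<^sub>F z in nhds 0 \<times>\<^sub>F nhds 0. (p + fst z) - (q + snd z) \<notin> N"
    if "p \<in> R" "q \<in> R" "p \<noteq> q" for p q
  proof -
    have "((\<lambda>z. (p + fst z) - (q + snd z)) \<longlongrightarrow> (p + 0) - (q + 0)) (nhds 0 \<times>\<^sub>F nhds 0)"
      by (intro tendsto_intros filterlim_fst filterlim_snd)
    moreover have "open (- N)" "(p + 0) - (q + 0) \<in> - N"
      using assms that by auto
    ultimately show ?thesis
      by (auto dest!: topological_tendstoD)
  qed
  then have "\<forall>\<^sub>F z in nhds 0 \<times>\<^sub>F nhds 0. \<forall>p\<in>R. \<forall>q\<in>R. p \<noteq> q \<longrightarrow> (p + fst z) - (q + snd z) \<notin> N"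
    using assms(1) by (intro eventually_ball_finite ballI) (auto intro: eventually_mono)
  then obtain Q where Q: "eventually Q (nhds (0::'g))"
    "\<And>x y. Q x \<Longrightarrow> Q y \<Longrightarrow> (\<forall>p\<in>R. \<forall>q\<in>R. p \<noteq> q \<longrightarrow> (p + x) - (q + y) \<notin> N)"
    unfolding eventually_prod_same by auto
  then show ?thesis
    unfolding eventually_nhds_metric by (metis dist_commute)
qed

text \<open>
  Mycielski's theorem for the relation \<open>x - y \<in> M\<close>. The value at \<open>a\<close> is the infinite sum
  \<open>f\<^sub>0 + f\<^sub>1 + \<dots>\<close> of a rapidly decreasing sequence, with the terms \<open>f\<^sub>n\<close> such that \<open>a n\<close> is false left out.
  The group structure makes a sequence sufficient where a general relation needs a tree of open
  sets: the single element \<open>f\<^sub>n\<close> is chosen generic over the finite set \<open>R\<close> of all partial sums of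
  length \<open>n\<close>. The hypothesis \<open>0 \<in> M\<close> makes partial sums along different branches distinct.
\<close>

lemma perfect_family_avoiding_meager_differences:
  fixes M :: "'g::{polish_space, topological_group_add} set"
  assumes "meager_in euclidean M" "0 \<in> M"
  shows "\<exists>h :: (nat \<Rightarrow> bool) \<Rightarrow> 'g. \<forall>a b. a \<noteq> b \<longrightarrow> h a - h b \<notin> M"
proof -
  obtain F :: "nat \<Rightarrow> 'g set"
    where F: "\<And>n. closed (F n)" "\<And>n. interior (F n) = {}" "M \<subseteq> (\<Union>n. F n)"
    using meager_in_closed_cover[OF assms(1)] by auto
  let ?M = "\<Union>n. F n"
  have meager: "meager_in euclidean ?M"
    using F(1,2) by (intro meager_in_UN nowhere_dense_imp_meager_in) (auto simp: nowhere_dense_in_def)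
  \<comment> \<open>The number \<open>r\<close> bounds all tails of the sum: adding tails to two distinct partial sums moves them little and keeps their difference out of the first closed sets covering \<open>M\<close>.\<close>
  define near where "near r n R \<longleftrightarrow> (\<forall>p\<in>R. \<forall>x. dist 0 x \<le> r \<longrightarrow> dist p (p + x) \<le> (1/2)^n)"
    for r n and R :: "'g set"
  define sep where "sep r n R \<longleftrightarrow> (\<forall>p\<in>R. \<forall>q\<in>R. p \<noteq> q \<longrightarrow>
      (\<forall>x y. dist 0 x \<le> r \<longrightarrow> dist 0 y \<le> r \<longrightarrow> (\<forall>k\<le>n. (p + x) - (q + y) \<notin> F k)))"
    for r n and R :: "'g set"
  define P where "P n = (\<lambda>(R, r, f). finite R \<and> 0 \<in> R \<and> 0 < r \<and> near r n R \<and> sep r n R \<and>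
      (\<forall>p\<in>R. \<forall>q\<in>R. p \<noteq> q \<longrightarrow> p - q \<notin> ?M) \<and> dist 0 f < r \<and>
      (\<forall>p\<in>R. \<forall>q\<in>R. p + f - q \<notin> ?M \<and> p - f - q \<notin> ?M))" for n
  define Q where "Q = (\<lambda>(R :: 'g set, r, f) (R', r', f' :: 'g). R' = R \<union> (\<lambda>p. p + f) ` R \<and> r' \<le> r \<and>
      (\<forall>x. dist 0 x \<le> r' \<longrightarrow> dist 0 (f + x) \<le> (r::real)))"
  have step: "\<exists>r f. P n (R, r, f) \<and> r \<le> t \<and> (\<forall>x. dist 0 x \<le> r \<longrightarrow> dist 0 (g + x) \<le> t)"
    if R: "finite R" "0 \<in> R" "\<And>p q. p \<in> R \<Longrightarrow> q \<in> R \<Longrightarrow> p \<noteq> q \<Longrightarrow> p - q \<notin> ?M"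
      and g: "dist 0 g < t" for n R t and g :: 'g
  proof -
    have "\<exists>d>0. \<forall>p\<in>R. \<forall>q\<in>R. p \<noteq> q \<longrightarrow>
      (\<forall>x y. dist 0 x < d \<longrightarrow> dist 0 y < d \<longrightarrow> (p + x) - (q + y) \<notin> (\<Union>k\<le>n. F k))"
      using R F(1) by (intro separate_finite_set_from_closed_differences) auto
    then obtain d1 where d1: "d1 > 0" "\<forall>p\<in>R. \<forall>q\<in>R. p \<noteq> q \<longrightarrow>
      (\<forall>x y. dist 0 x < d1 \<longrightarrow> dist 0 y < d1 \<longrightarrow> (p + x) - (q + y) \<notin> (\<Union>k\<le>n. F k))" by blast
    have "\<forall>\<^sub>F x in nhds 0. dist p (p + x) < (1/2)^n" for p :: 'g
    proof -
      have "((\<lambda>x. dist p (p + x)) \<longlongrightarrow> dist p (p + 0)) (nhds 0)"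
        by (intro tendsto_intros filterlim_ident)
      then show ?thesis
        by (rule order_tendstoD) simp
    qed
    then have "\<forall>\<^sub>F x in nhds 0. \<forall>p\<in>R. dist p (p + x) < (1/2)^n"
      using R(1) by (intro eventually_ball_finite) auto
    moreover have "\<forall>\<^sub>F x in nhds 0. dist 0 (g + x) < t"
    proof -
      have "((\<lambda>x. dist 0 (g + x)) \<longlongrightarrow> dist 0 (g + 0)) (nhds 0)"
        by (intro tendsto_intros filterlim_ident)
      then show ?thesis
        by (rule order_tendstoD) (simp add: g)
    qed
    ultimately have "\<forall>\<^sub>F x in nhds 0. (\<forall>p\<in>R. dist p (p + x) < (1/2)^n) \<and> dist 0 (g + x) < t"
      by eventually_elim auto
    then obtain d2 where d2: "d2 > 0"
      "\<And>x. dist 0 x < d2 \<Longrightarrow> (\<forall>p\<in>R. dist p (p + x) < (1/2)^n) \<and> dist 0 (g + x) < t"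
      unfolding eventually_nhds_metric by (metis dist_commute)
    have t: "0 < t"
      using le_less_trans[OF zero_le_dist g] .
    define r where "r = min t (min d1 d2 / 2)"
    have r: "r > 0" "r \<le> t" "r < d1" "r < d2"
      using d1(1) d2(1) t unfolding r_def by (auto simp: min_def)
    obtain f where f: "dist 0 f < r"
      "\<And>p q. p \<in> R \<Longrightarrow> q \<in> R \<Longrightarrow> p + f - q \<notin> ?M \<and> p - f - q \<notin> ?M"
      using meager_in_avoiding_differences_step[OF meager R(1) r(1)] by blast
    have "near r n R"
      unfolding near_def using d2(2) r(4) by (meson le_less_trans less_imp_le)
    moreover have "sep r n R"
      unfolding sep_def
    proof (intro ballI allI impI)
      fix p q x y :: 'g and k
      assume *: "p \<in> R" "q \<in> R" "p \<noteq> q" "dist 0 x \<le> r" "dist 0 y \<le> r" "k \<le> n"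
      then have "(p + x) - (q + y) \<notin> (\<Union>k\<le>n. F k)"
        using d1(2) r(3) by (meson le_less_trans)
      then show "(p + x) - (q + y) \<notin> F k"
        using *(6) by blast
    qed
    ultimately have "P n (R, r, f)"
      unfolding P_def prod.case using R r(1) f by blast
    moreover have "\<forall>x. dist 0 x \<le> r \<longrightarrow> dist 0 (g + x) \<le> t"
      using d2 r by (meson le_less_trans less_imp_le)
    ultimately show ?thesis
      using r(2) by blast
  qed
  have "\<exists>S. \<forall>n. P n (S n) \<and> Q (S n) (S (Suc n))"
  proof (rule dependent_nat_choice)
    show "\<exists>x. P 0 x"
      using step[of "{0}" 0 1 0] by auto
    fix x n assume "P n x"
    obtain R r f where x: "x = (R, r, f)" by (cases x)
    note Px = \<open>P n x\<close>[unfolded x P_def prod.case]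
    have neg: "p - (q + f) = p - f - q" for p q
      by (simp add: add.assoc diff_conv_add_uminus minus_add del: add_uminus_conv_diff)
    have "p - q \<notin> ?M" if "p \<in> R \<union> (\<lambda>p. p + f) ` R" "q \<in> R \<union> (\<lambda>p. p + f) ` R" "p \<noteq> q" for p q
      using that Px neg by auto
    then obtain r' f' where "P (Suc n) (R \<union> (\<lambda>p. p + f) ` R, r', f')" "r' \<le> r"
      "\<forall>x. dist 0 x \<le> r' \<longrightarrow> dist 0 (f + x) \<le> r"
      using step[of "R \<union> (\<lambda>p. p + f) ` R" f r "Suc n"] Px by auto
    then show "\<exists>y. P (Suc n) y \<and> Q x y"
      unfolding Q_def x by (intro exI[of _ "(R \<union> (\<lambda>p. p + f) ` R, r', f')"]) auto
  qed
  then obtain S where S: "\<And>n. P n (S n)" "\<And>n. Q (S n) (S (Suc n))" by blast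
  define R r f where "R n = fst (S n)" "r n = fst (snd (S n))" "f n = snd (snd (S n))" for n
  have S_eq: "S n = (R n, r n, f n)" for n
    by (simp add: R_r_f_def)
  note PS = S(1)[unfolded S_eq P_def prod.case] and QS = S(2)[unfolded S_eq Q_def prod.case]
  have near_R: "near (r n) n (R n)" and sep_R: "sep (r n) n (R n)" for n
    using PS[of n] by auto
  define s where "s a n = rec_nat 0 (\<lambda>n p. p + (if a n then f n else 0)) n" for a :: "nat \<Rightarrow> bool" and n
  have s_simps: "s a 0 = 0" "s a (Suc n) = s a n + (if a n then f n else 0)" for a n
    by (simp_all add: s_def)
  have s_in: "s a n \<in> R n" for a n
  proof (induction n)
    case 0
    then show ?case using PS[of 0] by (simp add: s_simps)
  next
    case (Suc n)
    then show ?case using QS[of n] by (auto simp: s_simps)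
  qed
  \<comment> \<open>A coincidence of partial sums over different branches would put \<open>0\<close> among the differences that \<open>f\<^sub>m\<close> was chosen to avoid.\<close>
  have s_inj: "\<forall>i<m. a i = b i" if "s a m = s b m" for a b m
    using that
  proof (induction m)
    case (Suc m)
    have "s c m + f m \<noteq> s c' m" for c c'
    proof
      assume "s c m + f m = s c' m"
      then have "s c m + f m - s c' m = 0" by simp
      then show False
        using PS[of m] s_in[of c m] s_in[of c' m] assms(2) F(3) by (metis subsetD)
    qed
    then have "a m = b m \<and> s a m = s b m"
      using Suc.prems by (auto simp: s_simps split: if_splits) metis+
    then show ?case
      using Suc.IH less_Suc_eq by auto
  qed simp
  have tail: "dist 0 (- s a m + s a (m + d)) \<le> r m" for a d m
  proof (induction d arbitrary: m)
    case 0
    then show ?case using PS[of m] by simp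
  next
    case (Suc d)
    let ?x = "- s a (Suc m) + s a (Suc m + d)"
    have "- s a m + s a (m + Suc d) = (- s a m + s a (Suc m)) + ?x"
      by (simp only: add.assoc add_minus_cancel add_Suc_right add_Suc)
    also have "- s a m + s a (Suc m) = (if a m then f m else 0)"
      by (simp add: s_simps add.assoc[symmetric])
    finally have "- s a m + s a (m + Suc d) = (if a m then f m else 0) + ?x" .
    moreover have "dist 0 ?x \<le> r (Suc m)" by (rule Suc.IH)
    ultimately show ?case
      using QS[of m] by (auto intro: order_trans)
  qed
  have "\<exists>l. s a \<longlonglongrightarrow> l" for a
  proof -
    have "dist (s a m) (s a (Suc m)) \<le> 2 * (1/2) ^ Suc m" for m
    proof -
      have "dist (s a m) (s a m + (- s a m + s a (m + 1))) \<le> (1/2)^m"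
        using near_R[of m] s_in[of a m] tail[of a m 1] unfolding near_def by blast
      then show ?thesis by simp
    qed
    then show ?thesis
      using geometric_steps_converge by blast
  qed
  then obtain h where h: "\<And>a. s a \<longlonglongrightarrow> h a" by metis
  have h_tail: "dist 0 (- s a m + h a) \<le> r m" for a m
  proof -
    have "(\<lambda>d. dist 0 (- s a m + s a (d + m))) \<longlonglongrightarrow> dist 0 (- s a m + h a)"
      by (intro tendsto_intros LIMSEQ_ignore_initial_segment h)
    moreover have "dist 0 (- s a m + s a (d + m)) \<le> r m" for d
      using tail[of a m d] by (simp only: add.commute[of d m])
    ultimately show ?thesis
      by (intro LIMSEQ_le_const2) auto
  qed
  have "h a - h b \<notin> F k" if "a \<noteq> b" for a b k
  proof -
    obtain n where "a n \<noteq> b n" using \<open>a \<noteq> b\<close> by blast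
    define m where "m = max (Suc n) k"
    have "s a m \<noteq> s b m"
      using s_inj[of a m b] \<open>a n \<noteq> b n\<close> by (auto simp: m_def)
    moreover have "k \<le> m" by (simp add: m_def)
    ultimately have "(s a m + (- s a m + h a)) - (s b m + (- s b m + h b)) \<notin> F k"
      using sep_R[of m] s_in[of a m] s_in[of b m] h_tail[of a m] h_tail[of b m]
      unfolding sep_def by blast
    then show ?thesis by simp
  qed
  then show ?thesis
    using F(3) by (intro exI[of _ h]) blast
qed

section \<open>Sections of meager sets in powers\<close>

lemma topspace_power_topology:
  "topspace (power_topology n :: (nat \<Rightarrow> 'a::topological_space) topology) = extensional {..<n}"
  by (simp add: power_topology_def PiE_def)

lemma completely_metrizable_power_topology:
  "completely_metrizable_space (power_topology n :: (nat \<Rightarrow> 'a::polish_space) topology)"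
  by (simp add: power_topology_def completely_metrizable_space_product_topology
      completely_metrizable_space_euclidean countable_finite)

lemma continuous_map_power_coordinate:
  "i < n \<Longrightarrow> continuous_map (power_topology n) euclidean (\<lambda>x. x i)"
  unfolding power_topology_def by (rule continuous_map_product_coordinates) simp

lemma continuous_map_power_update:
  "continuous_map (power_topology n) (power_topology (Suc n)) (\<lambda>x. x(n := y))"
  unfolding power_topology_def
  by (subst continuous_map_componentwise)
     (auto simp: PiE_def extensional_def less_Suc_eq intro: continuous_map_product_coordinates)

lemma continuous_map_power_restrict:
  "continuous_map (power_topology (Suc n)) (power_topology n) (\<lambda>x. restrict x {..<n})"
  unfolding power_topology_def
  by (subst continuous_map_componentwise) (auto intro: continuous_map_product_coordinates)

lemma openin_power_box:
  assumes "openin (power_topology n) U" "open V"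
  shows "openin (power_topology (Suc n)) {x(n := y) | x y. x \<in> U \<and> y \<in> V}"
proof -
  have "openin (power_topology (Suc n))
    ({z \<in> topspace (power_topology (Suc n)). restrict z {..<n} \<in> U} \<inter>
     {z \<in> topspace (power_topology (Suc n)). z n \<in> V})"
    using assms
    by (intro openin_Int openin_continuous_map_preimage[OF continuous_map_power_restrict]
        openin_continuous_map_preimage[OF continuous_map_power_coordinate]) auto
  also have "({z \<in> topspace (power_topology (Suc n)). restrict z {..<n} \<in> U} \<inter>
     {z \<in> topspace (power_topology (Suc n)). z n \<in> V}) = {x(n := y) | x y. x \<in> U \<and> y \<in> V}"
    (is "?L = ?R")
  proof (intro equalityI subsetI)
    fix z assume z: "z \<in> ?L"
    then have "z = (restrict z {..<n})(n := z n)"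
      by (auto simp: topspace_power_topology extensional_def fun_eq_iff less_Suc_eq)
    then show "z \<in> ?R" using z by blast
  next
    fix z assume "z \<in> ?R"
    then obtain x y where z: "z = x(n := y)" "x \<in> U" "y \<in> V" by blast
    have x: "x \<in> extensional {..<n}"
      using z(2) openin_subset[OF assms(1)] by (auto simp: topspace_power_topology)
    then have "restrict z {..<n} = x"
      by (auto simp: z(1) extensional_def)
    then show "z \<in> ?L"
      using z x by (auto simp: topspace_power_topology extensional_def)
  qed
  finally show ?thesis .
qed

text \<open>
  The Kuratowski-Ulam theorem for the splitting of \<open>X\<^sup>n\<^sup>+\<^sup>1\<close> into \<open>X\<^sup>n\<close> and \<open>X\<close>. If the section at \<open>x\<close> of a closed set \<open>F\<close>
  contains a basic open set \<open>B\<close>, then \<open>x\<close> is in the closed set \<open>E\<close> of all points whose section contains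
  \<open>B\<close>. An open subset \<open>U\<close> of \<open>E\<close> gives an open box over \<open>U\<close> and \<open>B\<close> inside \<open>F\<close>, so \<open>E\<close> is nowhere dense
  if \<open>F\<close> is; there are countably many \<open>B\<close>.
\<close>

lemma meager_sections:
  fixes S :: "(nat \<Rightarrow> 'a::second_countable_topology) set"
  assumes "meager_in (power_topology (Suc n)) S"
  shows "meager_in (power_topology n)
    {x \<in> topspace (power_topology n). \<not> meager_in euclidean {y. x(n := y) \<in> S}}"
proof -
  obtain F :: "nat \<Rightarrow> (nat \<Rightarrow> 'a) set"
    where F: "\<forall>k. closedin (power_topology (Suc n)) (F k) \<and> power_topology (Suc n) interior_of F k = {}"
      and S: "S \<subseteq> (\<Union>k. F k)"
    using meager_in_closed_cover[OF assms] by blast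
  obtain \<B> :: "'a set set" where \<B>: "countable \<B>" "topological_basis \<B>"
    using ex_countable_basis by blast
  define E where "E k B = {x \<in> topspace (power_topology n). \<forall>y\<in>B. x(n := y) \<in> F k}" for k B
  have "nowhere_dense_in (power_topology n) (E k B)" if "B \<in> \<B> - {{}}" for k B
  proof -
    have B: "open B" "B \<noteq> {}"
      using that \<B>(2) topological_basis_open by auto
    have "E k B = (\<Inter>y\<in>B. {x \<in> topspace (power_topology n). x(n := y) \<in> F k})"
      using B(2) by (auto simp: E_def)
    also have "closedin (power_topology n) \<dots>"
      using B(2) F by (intro closedin_INT closedin_continuous_map_preimage[OF continuous_map_power_update]) auto
    finally have closed: "closedin (power_topology n) (E k B)" .
    have "U = {}" if U: "openin (power_topology n) U" "U \<subseteq> E k B" for U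
    proof (rule ccontr)
      assume "U \<noteq> {}"
      have "{x(n := y) | x y. x \<in> U \<and> y \<in> B} \<subseteq> F k"
        using U(2) by (auto simp: E_def)
      then have "{x(n := y) | x y. x \<in> U \<and> y \<in> B} \<subseteq> power_topology (Suc n) interior_of F k"
        using openin_power_box[OF U(1) B(1)] by (rule interior_of_maximal)
      then show False
        using F \<open>U \<noteq> {}\<close> B(2) by auto
    qed
    then have "power_topology n interior_of E k B = {}"
      by (meson interior_of_subset openin_interior_of)
    then show ?thesis
      using closed closure_of_closedin[OF closed] closedin_subset[OF closed]
      by (simp add: nowhere_dense_in_def)
  qed
  then have "meager_in (power_topology n) (\<Union>k. \<Union>B\<in>\<B> - {{}}. E k B)"
    using \<B>(1) by (intro meager_in_UN nowhere_dense_imp_meager_in) auto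
  moreover have "meager_in euclidean {y. x(n := y) \<in> S}"
    if x: "x \<in> topspace (power_topology n)" "x \<notin> (\<Union>k. \<Union>B\<in>\<B> - {{}}. E k B)" for x
  proof -
    have "nowhere_dense_in euclidean {y. x(n := y) \<in> F k}" for k
    proof -
      have "continuous_map euclidean (power_topology (Suc n)) (\<lambda>y. x(n := y))"
        using x(1) unfolding power_topology_def
        by (subst continuous_map_componentwise) (auto simp: PiE_def extensional_def less_Suc_eq)
      then have "closedin euclidean {y \<in> topspace euclidean. x(n := y) \<in> F k}"
        using F by (intro closedin_continuous_map_preimage) auto
      then have closed: "closed {y. x(n := y) \<in> F k}"
        by simp
      have "interior {y. x(n := y) \<in> F k} = {}"
      proof (rule ccontr)
        assume "interior {y. x(n := y) \<in> F k} \<noteq> {}"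
        then obtain y where "y \<in> interior {y. x(n := y) \<in> F k}" by blast
        then obtain B where "B \<in> \<B>" "y \<in> B" "B \<subseteq> interior {y. x(n := y) \<in> F k}"
          using topological_basisE[OF \<B>(2) open_interior] by metis
        then have "x \<in> E k B" "B \<in> \<B> - {{}}"
          using interior_subset x(1) unfolding E_def by auto
        then show False using x(2) by blast
      qed
      then show ?thesis
        using closed by (simp add: nowhere_dense_in_def)
    qed
    then have "meager_in euclidean (\<Union>k. {y. x(n := y) \<in> F k})"
      by (intro meager_in_UN nowhere_dense_imp_meager_in) auto
    then show ?thesis
      by (rule meager_in_subset) (use S in auto)
  qed
  ultimately show ?thesis
    by (elim meager_in_subset) blast
qed

section \<open>Generic tuples and their stabilizers\<close>

text \<open>
  For \<open>n = 0\<close> the one-point space is its own comeager orbit, so that trees of generic tuples can start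
  from the empty tuple.
\<close>

definition generic_tuple :: "nat \<Rightarrow> (nat \<Rightarrow> 'g::{polish_space, topological_group_add}) \<Rightarrow> bool" where
  "generic_tuple n x \<longleftrightarrow> x \<in> extensional {..<n} \<and> comeager_in (power_topology n) (diagonal_orbit n x)"


lemma generic_tuple_0: "generic_tuple 0 (\<lambda>_. undefined)"
  by (auto simp: generic_tuple_def comeager_in_def diagonal_orbit_def diagonal_conjugation_def
      topspace_power_topology meager_in_def restrict_def intro!: exI[of _ "{}"])

lemma generic_tuple_exists:
  assumes "ample_generic_elements TYPE('g::{polish_space, topological_group_add})"
  shows "\<exists>x :: nat \<Rightarrow> 'g. generic_tuple n x"
proof (cases "n \<ge> 1")
  case True
  then show ?thesis
    using assms unfolding ample_generic_elements_def generic_tuple_def topspace_power_topology by blast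
next
  case False
  then show ?thesis
    using generic_tuple_0 by (auto simp: not_le)
qed

lemma diagonal_conjugation_add:
  "diagonal_conjugation n (g + h) x = diagonal_conjugation n g (diagonal_conjugation n h x)"
  by (auto simp: diagonal_conjugation_def fun_eq_iff conjugate_add[unfolded conjugate_def])

lemma diagonal_conjugation_update:
  "diagonal_conjugation (Suc n) g (x(n := y)) = (diagonal_conjugation n g x)(n := conjugate g y)"
  by (auto simp: diagonal_conjugation_def conjugate_def fun_eq_iff less_Suc_eq)

lemma diagonal_orbit_conjugation:
  "diagonal_orbit n (diagonal_conjugation n h x) = diagonal_orbit n x"
proof -
  have "diagonal_conjugation n g x = diagonal_conjugation n (g - h) (diagonal_conjugation n h x)" for g
    by (simp flip: diagonal_conjugation_add)
  then have "diagonal_orbit n x \<subseteq> diagonal_orbit n (diagonal_conjugation n h x)"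
    unfolding diagonal_orbit_def by blast
  moreover have "diagonal_orbit n (diagonal_conjugation n h x) \<subseteq> diagonal_orbit n x"
    by (auto simp: diagonal_orbit_def simp flip: diagonal_conjugation_add)
  ultimately show ?thesis by blast
qed

lemma generic_tuple_conjugation:
  assumes "x \<in> extensional {..<n}"
  shows "generic_tuple n (diagonal_conjugation n g x) \<longleftrightarrow> generic_tuple n x"
proof -
  have "diagonal_conjugation n g x \<in> extensional {..<n}"
    by (simp add: diagonal_conjugation_def)
  with assms show ?thesis
    by (simp add: generic_tuple_def diagonal_orbit_conjugation)
qed

lemma comeager_orbit_not_meager:
  fixes x :: "nat \<Rightarrow> 'g::{polish_space, topological_group_add}"
  assumes "generic_tuple n x" "meager_in (power_topology n) E"
  shows "\<not> diagonal_orbit n x \<subseteq> E"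
proof
  let ?X = "power_topology n :: (nat \<Rightarrow> 'g) topology"
  assume "diagonal_orbit n x \<subseteq> E"
  then have "topspace ?X \<subseteq> E \<union> (topspace ?X - diagonal_orbit n x)"
    by blast
  moreover have "meager_in ?X (E \<union> (topspace ?X - diagonal_orbit n x))"
    using assms by (intro meager_in_Un) (auto simp: generic_tuple_def comeager_in_def)
  ultimately have "meager_in ?X (topspace ?X)"
    using meager_in_subset by blast
  moreover have "x \<in> topspace ?X"
    using assms(1) by (simp add: generic_tuple_def topspace_power_topology)
  ultimately show False
    using nonempty_open_not_meager_in[OF completely_metrizable_power_topology openin_topspace] by blast
qed

text \<open>
  Two comeager orbits meet, hence coincide.
\<close>

lemma generic_tuples_conjugate:
  assumes "generic_tuple n x" "generic_tuple n y"
  shows "\<exists>g. diagonal_conjugation n g x = y"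
proof -
  let ?X = "power_topology n :: (nat \<Rightarrow> 'a) topology"
  have "\<not> diagonal_orbit n x \<subseteq> topspace ?X - diagonal_orbit n y"
    using assms by (intro comeager_orbit_not_meager) (auto simp: generic_tuple_def comeager_in_def)
  moreover have "diagonal_orbit n x \<subseteq> topspace ?X"
    using assms(1) by (simp add: generic_tuple_def comeager_in_def)
  ultimately have "diagonal_orbit n x \<inter> diagonal_orbit n y \<noteq> {}"
    by blast
  then obtain g h where gh: "diagonal_conjugation n g x = diagonal_conjugation n h y"
    unfolding diagonal_orbit_def by auto
  have "y = diagonal_conjugation n (- h + h) y"
    using assms(2) by (auto simp: diagonal_conjugation_def generic_tuple_def extensional_def fun_eq_iff)
  then have "diagonal_conjugation n (- h + g) x = y"
    unfolding diagonal_conjugation_add gh by simp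
  then show ?thesis by blast
qed

text \<open>
  By \<open>meager_sections\<close> this holds for almost every \<open>n\<close>-tuple, hence for some tuple in the comeager orbit
  of \<open>x\<close>. Conjugation carries it over to \<open>x\<close>.
\<close>

lemma comeager_generic_extensions:
  fixes x :: "nat \<Rightarrow> 'g::{polish_space, topological_group_add}"
  assumes "ample_generic_elements TYPE('g)" "generic_tuple n x"
  shows "meager_in euclidean {y. \<not> generic_tuple (Suc n) (x(n := y))}"
proof -
  let ?X = "\<lambda>n. power_topology n :: (nat \<Rightarrow> 'g) topology"
  obtain z :: "nat \<Rightarrow> 'g" where z: "generic_tuple (Suc n) z"
    using generic_tuple_exists[OF assms(1)] by blast
  let ?S = "topspace (?X (Suc n)) - diagonal_orbit (Suc n) z"
  let ?E = "{x' \<in> topspace (?X n). \<not> meager_in euclidean {y. x'(n := y) \<in> ?S}}"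
  have "meager_in (?X n) ?E"
    using z by (intro meager_sections) (simp add: generic_tuple_def comeager_in_def)
  then have "\<not> diagonal_orbit n x \<subseteq> ?E"
    using assms(2) by (rule comeager_orbit_not_meager[rotated])
  then obtain k where k: "diagonal_conjugation n k x \<notin> ?E"
    unfolding diagonal_orbit_def by blast
  define x' where "x' = diagonal_conjugation n k x"
  have ext: "x \<in> extensional {..<n}" "x' \<in> extensional {..<n}"
    using assms(2) by (auto simp: x'_def diagonal_conjugation_def generic_tuple_def)
  then have "meager_in euclidean {y. x'(n := y) \<in> ?S}"
    using k by (simp add: x'_def[symmetric] topspace_power_topology)
  then have meager: "meager_in euclidean (conjugate (- k) ` {y. x'(n := y) \<in> ?S})"
    by (rule meager_in_conjugate_image)
  have "y \<in> conjugate (- k) ` {y. x'(n := y) \<in> ?S}" if "\<not> generic_tuple (Suc n) (x(n := y))" for y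
  proof -
    have xy: "x(n := y) \<in> extensional {..<Suc n}"
      using ext by (auto simp: extensional_def)
    then have "\<not> generic_tuple (Suc n) (x'(n := conjugate k y))"
      using that generic_tuple_conjugation[OF xy, of k]
      by (simp add: diagonal_conjugation_update x'_def)
    then have "x'(n := conjugate k y) \<notin> diagonal_orbit (Suc n) z"
      using z generic_tuple_conjugation[of z "Suc n"]
      unfolding diagonal_orbit_def by (auto simp: generic_tuple_def)
    moreover have "x'(n := conjugate k y) \<in> topspace (?X (Suc n))"
      using ext by (auto simp: topspace_power_topology extensional_def)
    ultimately have "conjugate k y \<in> {y. x'(n := y) \<in> ?S}"
      by blast
    then show ?thesis
      by (metis conjugate_minus_cancel(1) imageI)
  qed
  then show ?thesis
    by (intro meager_in_subset[OF meager]) blast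
qed

definition tuple_stabilizer :: "nat \<Rightarrow> (nat \<Rightarrow> 'g::group_add) \<Rightarrow> 'g set" where
  "tuple_stabilizer n x = {g. \<forall>i<n. conjugate g (x i) = x i}"

lemma tuple_stabilizer_0: "0 \<in> tuple_stabilizer n x"
  by (simp add: tuple_stabilizer_def)

lemma tuple_stabilizer_add:
  "g \<in> tuple_stabilizer n x \<Longrightarrow> h \<in> tuple_stabilizer n x \<Longrightarrow> g + h \<in> tuple_stabilizer n x"
  by (simp add: tuple_stabilizer_def conjugate_add)

lemma tuple_stabilizer_minus: "- g \<in> tuple_stabilizer n x" if "g \<in> tuple_stabilizer n x"
proof -
  have "conjugate (- g) (x i) = x i" if "i < n" for i
  proof -
    have "conjugate g (x i) = x i"
      using \<open>g \<in> tuple_stabilizer n x\<close> that by (simp add: tuple_stabilizer_def)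
    then have "conjugate (- g) (x i) = conjugate (- g) (conjugate g (x i))"
      by simp
    then show ?thesis by simp
  qed
  then show ?thesis by (simp add: tuple_stabilizer_def)
qed

lemma closed_tuple_stabilizer:
  fixes x :: "nat \<Rightarrow> 'g::{t2_space, topological_group_add}"
  shows "closed (tuple_stabilizer n x)"
proof -
  have "tuple_stabilizer n x = (\<Inter>i\<in>{..<n}. {g. conjugate g (x i) = x i})"
    by (auto simp: tuple_stabilizer_def)
  also have "closed \<dots>"
    unfolding conjugate_def by (intro closed_INT ballI closed_Collect_eq continuous_intros)
  finally show ?thesis .
qed

text \<open>
  A conjugation that takes \<open>x(n := y)\<close> to \<open>x(n := y')\<close> fixes the first \<open>n\<close> entries.
\<close>

lemma tuple_stabilizer_transitive:
  assumes "x \<in> extensional {..<n}"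
    "generic_tuple (Suc n) (x(n := y))" "generic_tuple (Suc n) (x(n := y'))"
  shows "\<exists>k\<in>tuple_stabilizer n x. conjugate k y = y'"
proof -
  obtain k where k: "diagonal_conjugation (Suc n) k (x(n := y)) = x(n := y')"
    using generic_tuples_conjugate[OF assms(2,3)] by blast
  then have "(diagonal_conjugation n k x)(n := conjugate k y) = x(n := y')"
    by (simp only: diagonal_conjugation_update)
  then have "conjugate k y = y'" "\<And>i. i < n \<Longrightarrow> diagonal_conjugation n k x i = x i"
    by (metis fun_upd_same, metis fun_upd_other less_irrefl)
  then show ?thesis
    by (auto simp: tuple_stabilizer_def diagonal_conjugation_def conjugate_def)
qed

lemma tuple_stabilizer_preserves_generic:
  assumes "x \<in> extensional {..<n}" "k \<in> tuple_stabilizer n x" "generic_tuple (Suc n) (x(n := y))"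
  shows "generic_tuple (Suc n) (x(n := conjugate k y))"
proof -
  have "diagonal_conjugation n k x = x"
    using assms(1,2)
    by (auto simp: diagonal_conjugation_def tuple_stabilizer_def conjugate_def extensional_def)
  moreover have "x(n := y) \<in> extensional {..<Suc n}"
    using assms(3) by (simp add: generic_tuple_def)
  ultimately show ?thesis
    using assms(3) generic_tuple_conjugation[of "x(n := y)" "Suc n" k]
    by (simp add: diagonal_conjugation_update)
qed

section \<open>Openness of orbit maps\<close>

text \<open>
  The situation in which Effros's theorem is needed: \<open>K\<close> is the stabilizer of a generic tuple and \<open>C\<close> is
  the set of its generic one-step extensions.
\<close>

locale conjugacy_orbit =
  fixes K C :: "'g::{polish_space, topological_group_add} set"
  assumes K_0: "0 \<in> K"
    and K_add: "g \<in> K \<Longrightarrow> h \<in> K \<Longrightarrow> g + h \<in> K"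
    and K_minus: "g \<in> K \<Longrightarrow> - g \<in> K"
    and K_closed: "closed K"
    and C_comeager: "meager_in euclidean (- C)"
    and C_invariant: "k \<in> K \<Longrightarrow> y \<in> C \<Longrightarrow> conjugate k y \<in> C"
    and K_transitive: "y \<in> C \<Longrightarrow> y' \<in> C \<Longrightarrow> \<exists>k\<in>K. conjugate k y = y'"
begin

text \<open>
  \<open>K\<close> is covered by countably many translates of \<open>V \<inter> K\<close>, so the orbit \<open>C\<close> is covered by countably many
  conjugates of the image \<open>D\<close> of \<open>V \<inter> K\<close>. As \<open>C\<close> is comeager, \<open>D\<close> is dense in some nonempty open set.
  Moving a point of \<open>D\<close> in this open set back to \<open>y\<close> costs one more element of \<open>V\<close>.
\<close>

lemma orbit_map_almost_open:
  assumes y: "y \<in> C" and W: "open W" "0 \<in> W"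
  shows "y \<in> interior (closure ((\<lambda>k. conjugate k y) ` (W \<inter> K)))"
proof -
  obtain V where V: "open V" "0 \<in> V" "\<And>x. x \<in> V \<Longrightarrow> - x \<in> V"
    "\<And>x y. x \<in> V \<Longrightarrow> y \<in> V \<Longrightarrow> x + y \<in> W"
    using symmetric_halving[OF W] by blast
  define D where "D = (\<lambda>k. conjugate k y) ` (V \<inter> K)"
  let ?T = "\<lambda>k. (\<lambda>x. - k + x) -` V"
  obtain \<F> where \<F>: "\<F> \<subseteq> ?T ` K" "countable \<F>" "\<Union>\<F> = \<Union>(?T ` K)"
  proof (rule Lindelof[of "?T ` K"])
    fix S assume "S \<in> ?T ` K"
    then show "open S"
      using V(1) by (auto intro!: open_vimage continuous_intros)
  qed
  then obtain K' where K': "K' \<subseteq> K" "countable K'" "\<F> = ?T ` K'"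
    by (metis countable_subset_image)
  have "C \<subseteq> (\<Union>k\<in>K'. conjugate k ` D)"
  proof
    fix c assume "c \<in> C"
    then obtain k where k: "k \<in> K" "conjugate k y = c"
      using K_transitive y by blast
    have "k \<in> \<Union>(?T ` K)"
      using k(1) V(2) by (intro UN_I[of k]) auto
    then have "k \<in> \<Union>(?T ` K')"
      using \<F>(3) K'(3) by simp
    then obtain k' where k': "k' \<in> K'" "- k' + k \<in> V"
      by auto
    then have "- k' + k \<in> V \<inter> K"
      using k(1) K'(1) K_add K_minus by blast
    moreover have "c = conjugate k' (conjugate (- k' + k) y)"
      using k(2) by (simp add: conjugate_add)
    ultimately show "c \<in> (\<Union>k\<in>K'. conjugate k ` D)"
      using k'(1) unfolding D_def by blast
  qed
  then have cover: "UNIV \<subseteq> (\<Union>k\<in>K'. conjugate k ` D) \<union> - C"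
    by blast
  have "\<not> nowhere_dense_in euclidean D"
  proof
    assume "nowhere_dense_in euclidean D"
    then have "meager_in euclidean (\<Union>k\<in>K'. conjugate k ` D)"
      using K'(2) by (intro meager_in_UN meager_in_conjugate_image nowhere_dense_imp_meager_in)
    then have "meager_in euclidean ((\<Union>k\<in>K'. conjugate k ` D) \<union> - C)"
      using C_comeager by (rule meager_in_Un)
    then have "meager_in euclidean (UNIV :: 'g set)"
      by (rule meager_in_subset[OF _ cover])
    then show False
      using nonempty_open_not_meager_in[OF completely_metrizable_space_euclidean, of "UNIV :: 'g set"]
      by simp
  qed
  then have "interior (closure D) \<noteq> {}"
    by (simp add: nowhere_dense_in_def)
  then have "interior (closure D) \<inter> D \<noteq> {}"
    using open_Int_closure_eq_empty[OF open_interior, of "closure D" D] interior_subset by blast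
  then obtain v where v: "v \<in> V" "v \<in> K" "conjugate v y \<in> interior (closure D)"
    unfolding D_def by blast
  let ?I = "conjugate (- v) ` interior (closure D)"
  have "open ?I"
    using homeomorphic_imp_open_map[OF homeomorphic_map_conjugate[of "- v"]] by (simp add: open_map_def)
  moreover have "?I \<subseteq> closure ((\<lambda>k. conjugate k y) ` (W \<inter> K))"
  proof -
    have "?I \<subseteq> conjugate (- v) ` closure D"
      using interior_subset by blast
    also have "\<dots> = closure (conjugate (- v) ` D)"
      using homeomorphic_map_closure_of[OF homeomorphic_map_conjugate[of "- v"], of D] by simp
    also have "conjugate (- v) ` D \<subseteq> (\<lambda>k. conjugate k y) ` (W \<inter> K)"
    proof
      fix z assume "z \<in> conjugate (- v) ` D"
      then obtain k where k: "k \<in> V" "k \<in> K" "z = conjugate (- v) (conjugate k y)"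
        unfolding D_def by blast
      then have "z = conjugate (- v + k) y" "- v + k \<in> W \<inter> K"
        using v V K_add K_minus by (auto simp: conjugate_add)
      then show "z \<in> (\<lambda>k. conjugate k y) ` (W \<inter> K)" by blast
    qed
    then have "closure (conjugate (- v) ` D) \<subseteq> closure ((\<lambda>k. conjugate k y) ` (W \<inter> K))"
      by (rule closure_mono)
    finally show ?thesis .
  qed
  moreover have "y \<in> ?I"
    using v(3) by (metis conjugate_minus_cancel(1) imageI)
  ultimately show ?thesis
    using interior_maximal by blast
qed

text \<open>
  Effros's theorem, by the back-and-forth argument familiar from the open mapping theorem. A point
  \<open>c\<close> of \<open>C\<close> near \<open>y\<close> is moved towards \<open>y\<close> and \<open>y\<close> towards \<open>c\<close> in turns, by smaller and smaller
  elements of \<open>K\<close>; each move is possible since the other point stays in the interior of the closure of what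
  can be reached. The two sequences of moves converge to \<open>a\<close> and \<open>b\<close> in \<open>K\<close>, both close to \<open>0\<close>, that send
  \<open>y\<close> and \<open>c\<close> to the same point, so \<open>- b + a\<close> sends \<open>y\<close> to \<open>c\<close>.
\<close>

lemma orbit_map_open:
  assumes y: "y \<in> C" and W: "open W" "0 \<in> W"
  shows "\<exists>U. open U \<and> y \<in> U \<and> (\<forall>c\<in>C \<inter> U. \<exists>k\<in>W \<inter> K. conjugate k y = c)"
proof -
  obtain V where V: "open V" "0 \<in> V" "\<And>x. x \<in> V \<Longrightarrow> - x \<in> V"
    "\<And>x y. x \<in> V \<Longrightarrow> y \<in> V \<Longrightarrow> x + y \<in> W"
    using symmetric_halving[OF W] by blast
  obtain r where r: "r > 0" "cball 0 r \<subseteq> V"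
    using V(1,2) open_contains_cball by blast
  \<comment> \<open>Adding an element of \<open>nb g n\<close> on the left moves \<open>g\<close> by less than a term of a series with sum at most \<open>r\<close>.\<close>
  define nb where "nb g n = {p. dist (p + g) g < r * (1/2)^(n + 2)}" for g :: 'g and n :: nat
  have nb: "open (nb g n)" "0 \<in> nb g n" for g n
    unfolding nb_def using r(1) by (auto intro!: open_Collect_less continuous_intros)
  define N where "N z P = interior (closure ((\<lambda>k. conjugate k z) ` (P \<inter> K)))" for z and P :: "'g set"
  have N_self: "z \<in> N z (nb g n)" if "z \<in> C" for z g n
    unfolding N_def by (intro orbit_map_almost_open nb that)
  have "\<exists>k\<in>W \<inter> K. conjugate k y = c" if c: "c \<in> C" "c \<in> N y (nb 0 0)" for c
  proof -
    \<comment> \<open>The even steps move \<open>y\<close> and the odd steps move \<open>c\<close>; a state consists of the last two accumulated group elements.\<close>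
    define z where "z n g = conjugate g (if even n then y else c)" for n :: nat and g
    have z_C: "z n g \<in> C" if "g \<in> K" for n g
      using that y c(1) C_invariant by (simp add: z_def)
    define P where "P n = (\<lambda>(g, g'). g \<in> K \<and> g' \<in> K \<and> (n = 0 \<longrightarrow> g = 0 \<and> g' = 0) \<and>
        z (Suc n) g' \<in> N (z n g) (nb g n))" for n
    define Q where "Q n = (\<lambda>(g, g') (h, h'). h = g' \<and> dist g h' \<le> r * (1/2)^(n + 2) \<and>
        dist (z (Suc n) g') (z (Suc (Suc n)) h') < (1/2)^n)" for n
    have "\<exists>S. \<forall>n. P n (S n) \<and> Q n (S n) (S (Suc n))"
    proof (rule dependent_nat_choice)
      show "\<exists>s. P 0 s"
        using c(2) K_0 by (intro exI[of _ "(0, 0)"]) (simp add: P_def z_def)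
      fix s n assume "P n s"
      obtain g g' where s: "s = (g, g')" by (cases s)
      let ?w = "z (Suc n) g'"
      have gg': "g \<in> K" "g' \<in> K" "?w \<in> N (z n g) (nb g n)"
        using \<open>P n s\<close> by (auto simp: s P_def)
      let ?T = "N ?w (nb g' (Suc n)) \<inter> ball ?w ((1/2)^n)"
      have "open ?T" "?w \<in> ?T"
        using N_self z_C gg'(2) by (auto simp: N_def)
      moreover have "?w \<in> closure ((\<lambda>k. conjugate k (z n g)) ` (nb g n \<inter> K))"
        using gg'(3) interior_subset unfolding N_def by blast
      ultimately have "?T \<inter> (\<lambda>k. conjugate k (z n g)) ` (nb g n \<inter> K) \<noteq> {}"
        using open_Int_closure_eq_empty by blast
      then obtain p where p: "p \<in> nb g n" "p \<in> K" "conjugate p (z n g) \<in> ?T"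
        by blast
      have "conjugate p (z n g) = z (Suc (Suc n)) (p + g)"
        by (simp add: z_def conjugate_add)
      then have "P (Suc n) (g', p + g)" "Q n s (g', p + g)"
        using p gg' K_add unfolding P_def Q_def s nb_def by (auto simp: dist_commute less_imp_le)
      then show "\<exists>t. P (Suc n) t \<and> Q n s t" by blast
    qed
    then obtain S where S: "\<And>n. P n (S n)" "\<And>n. Q n (S n) (S (Suc n))" by blast
    define u where "u n = fst (S n)" for n
    have S_eq: "S n = (u n, u (Suc n))" for n
      using S(2)[of n] by (cases "S n"; cases "S (Suc n)") (auto simp: u_def Q_def)
    have u_K: "u n \<in> K" for n
      using S(1)[of n] unfolding S_eq P_def by simp
    have u_start: "u 0 = 0" "u 1 = 0"
      using S(1)[of 0] unfolding S_eq P_def by auto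
    have u_step: "dist (u n) (u (Suc (Suc n))) \<le> r * (1/2)^(n + 2)"
      and z_step: "dist (z (Suc n) (u (Suc n))) (z (Suc (Suc n)) (u (Suc (Suc n)))) < (1/2)^n" for n
      using S(2)[of n] unfolding S_eq Q_def by auto
    have limit: "\<exists>l. (\<lambda>n. u (2 * n + i)) \<longlonglongrightarrow> l \<and> dist 0 l \<le> r" if "i = 0 \<or> i = 1" for i
    proof -
      have "dist (u (2 * n + i)) (u (2 * Suc n + i)) \<le> r * (1/2) ^ Suc n" for n
      proof -
        have "(1/2 :: real)^(2 * n + i + 2) \<le> (1/2) ^ Suc n"
          by (rule power_decreasing) auto
        then have "r * (1/2)^(2 * n + i + 2) \<le> r * (1/2) ^ Suc n"
          using r(1) by (intro mult_left_mono) auto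
        then show ?thesis
          using u_step[of "2 * n + i"] by simp
      qed
      from geometric_steps_converge[of "\<lambda>n. u (2 * n + i)", OF this] show ?thesis
        using that u_start by auto
    qed
    obtain a where a: "(\<lambda>n. u (2 * n)) \<longlonglongrightarrow> a" "dist 0 a \<le> r"
      using limit[of 0] by auto
    obtain b where b: "(\<lambda>n. u (2 * n + 1)) \<longlonglongrightarrow> b" "dist 0 b \<le> r"
      using limit[of 1] by auto
    have ab_K: "a \<in> K" "b \<in> K"
      using closed_sequentially[OF K_closed _ a(1)] closed_sequentially[OF K_closed _ b(1)] u_K by auto
    have "(\<lambda>n. dist (conjugate (u (2 * n + 1)) c) (conjugate (u (2 * Suc n)) y))
        \<longlonglongrightarrow> dist (conjugate b c) (conjugate a y)"
      unfolding conjugate_def by (intro tendsto_intros b(1) LIMSEQ_Suc[OF a(1)])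
    moreover have "(\<lambda>n. (1/4 :: real) ^ n) \<longlonglongrightarrow> 0"
      by (rule LIMSEQ_power_zero) simp
    moreover have "dist (conjugate (u (2 * n + 1)) c) (conjugate (u (2 * Suc n)) y) \<le> (1/4) ^ n" for n
      using z_step[of "2 * n"] by (simp add: z_def power_mult power2_eq_square)
    ultimately have "dist (conjugate b c) (conjugate a y) \<le> 0"
      by (intro LIMSEQ_le) auto
    then have "conjugate (- b) (conjugate b c) = conjugate (- b) (conjugate a y)"
      by simp
    then have "conjugate (- b + a) y = c"
      by (simp add: conjugate_add)
    moreover have "- b + a \<in> W \<inter> K"
      using a(2) b(2) r(2) V(3,4) ab_K K_add K_minus by (meson IntI mem_cball subsetD)
    ultimately show ?thesis by blast
  qed
  then show ?thesis
    using N_self[OF y] by (intro exI[of _ "N y (nb 0 0)"]) (auto simp: N_def)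
qed

end

section \<open>A perfect family of conjugations\<close>

text \<open>
  Let \<open>C\<close> be the comeager set of generic extensions of \<open>x\<close>. Since \<open>A\<close> is nonmeager it contains a point \<open>y\<close> of
  \<open>C\<close>. Points of \<open>C\<close> near \<open>y\<close> are images of \<open>y\<close> under small elements of the stabilizer, and \<open>B\<close> contains
  such a point because it is nonmeager near \<open>y\<close>.
\<close>

lemma near_generic_extensions:
  fixes x :: "nat \<Rightarrow> 'g::{polish_space, topological_group_add}"
  assumes ample: "ample_generic_elements TYPE('g)" and x: "generic_tuple n x"
    and A: "\<not> meager_in euclidean A"
    and B: "\<And>U. open U \<Longrightarrow> U \<noteq> {} \<Longrightarrow> \<not> meager_in euclidean (B \<inter> U)"
    and W: "open W" "0 \<in> W"
  shows "\<exists>y\<in>A. \<exists>y'\<in>B. \<exists>f\<in>W \<inter> tuple_stabilizer n x. conjugate f y' = y \<and>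
    generic_tuple (Suc n) (x(n := y)) \<and> generic_tuple (Suc n) (x(n := y'))"
proof -
  let ?C = "{y. generic_tuple (Suc n) (x(n := y))}"
  have ext: "x \<in> extensional {..<n}"
    using x by (simp add: generic_tuple_def)
  have C: "meager_in euclidean (- ?C)"
    using comeager_generic_extensions[OF ample x] by (simp add: Collect_neg_eq)
  interpret conjugacy_orbit "tuple_stabilizer n x" ?C
    using C ext
    by unfold_locales (auto intro: tuple_stabilizer_0 tuple_stabilizer_add tuple_stabilizer_minus
      closed_tuple_stabilizer tuple_stabilizer_transitive tuple_stabilizer_preserves_generic)
  obtain V where V: "open V" "0 \<in> V" "\<And>x. x \<in> V \<Longrightarrow> - x \<in> V"
    "\<And>x y. x \<in> V \<Longrightarrow> y \<in> V \<Longrightarrow> x + y \<in> W"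
    using symmetric_halving[OF W] by blast
  have "\<not> A \<subseteq> - ?C"
    using A meager_in_subset[OF C] by blast
  then obtain y where y: "y \<in> A" "y \<in> ?C" by blast
  obtain U where U: "open U" "y \<in> U" "\<And>c. c \<in> ?C \<inter> U \<Longrightarrow> \<exists>k\<in>V \<inter> tuple_stabilizer n x. conjugate k y = c"
    using orbit_map_open[OF y(2) V(1,2)] by blast
  have "\<not> B \<inter> U \<subseteq> - ?C"
    using B[OF U(1)] U(2) meager_in_subset[OF C] by blast
  then obtain y' where y': "y' \<in> B" "y' \<in> U" "y' \<in> ?C" by blast
  obtain k where k: "k \<in> V" "k \<in> tuple_stabilizer n x" "conjugate k y = y'"
    using U(3) y'(2,3) by blast
  have "- k + 0 \<in> W"
    using V(2,3,4) k(1) by blast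
  then have "- k \<in> W \<inter> tuple_stabilizer n x"
    using k(2) by (simp add: tuple_stabilizer_minus)
  moreover have "conjugate (- k) y' = y"
    using k(3) by auto
  ultimately show ?thesis
    using y y' by blast
qed

text \<open>
  A node at level \<open>n\<close> consists of a generic tuple \<open>x\<close> and a group element \<open>g\<close>. Its false branch appends to \<open>x\<close>
  some \<open>y \<in> A\<close> and keeps \<open>g\<close>; its true branch appends some \<open>y' \<in> B\<close> and replaces \<open>g\<close> by \<open>g + f\<close>, where \<open>f\<close> is
  small, fixes \<open>x\<close> and conjugates \<open>y'\<close> to \<open>y\<close>. Then \<open>g\<close> acts on \<open>y\<close> as \<open>g + f\<close> acts on \<open>y'\<close>. All later increments
  fix the appended entry, so the limits along the two branches still conjugate \<open>y\<close> and \<open>y'\<close> to the same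
  element.
\<close>

lemma perfect_family_conjugating:
  fixes A B :: "'g::{polish_space, topological_group_add} set"
  assumes ample: "ample_generic_elements TYPE('g)"
    and A: "\<not> meager_in euclidean A"
    and B: "\<And>U. open U \<Longrightarrow> U \<noteq> {} \<Longrightarrow> \<not> meager_in euclidean (B \<inter> U)"
  shows "\<exists>h :: (nat \<Rightarrow> bool) \<Rightarrow> 'g. \<forall>a b n. (\<forall>i<n. a i = b i) \<longrightarrow> \<not> a n \<longrightarrow> b n \<longrightarrow>
    (\<exists>y\<in>A. conjugate (- h b + h a) y \<in> B)"
proof -
  have "\<exists>y y' f. generic_tuple n x \<longrightarrow> y \<in> A \<and> y' \<in> B \<and> f \<in> tuple_stabilizer n x \<and>
      conjugate f y' = y \<and> dist g (g + f) \<le> 1 * (1/2) ^ Suc n \<and>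
      generic_tuple (Suc n) (x(n := y)) \<and> generic_tuple (Suc n) (x(n := y'))"
    for n and x :: "nat \<Rightarrow> 'g" and g :: 'g
  proof (cases "generic_tuple n x")
    case True
    let ?W = "{f. dist g (g + f) < (1/2) ^ Suc n}"
    have "open ?W" "0 \<in> ?W"
      by (auto intro!: open_Collect_less continuous_intros)
    from near_generic_extensions[OF ample True A B this] show ?thesis
      by (auto intro: less_imp_le)
  qed blast
  then obtain Y Y' F where YF:
    "\<And>n x g. generic_tuple n x \<Longrightarrow> Y n x g \<in> A \<and> Y' n x g \<in> B \<and> F n x g \<in> tuple_stabilizer n x \<and>
      conjugate (F n x g) (Y' n x g) = Y n x g \<and> dist g (g + F n x g) \<le> 1 * (1/2) ^ Suc n \<and>
      generic_tuple (Suc n) (x(n := Y n x g)) \<and> generic_tuple (Suc n) (x(n := Y' n x g))"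
    by metis
  define st where "st a = rec_nat (\<lambda>_. undefined, 0) (\<lambda>n (x, g). if a n
      then (x(n := Y' n x g), g + F n x g) else (x(n := Y n x g), g))" for a :: "nat \<Rightarrow> bool"
  define X H where "X a n = fst (st a n)" and "H a n = snd (st a n)" for a n
  have X_0: "X a 0 = (\<lambda>_. undefined)" and H_0: "H a 0 = 0" for a
    by (simp_all add: X_def H_def st_def)
  have X_Suc: "X a (Suc n) = (X a n)(n := if a n then Y' n (X a n) (H a n) else Y n (X a n) (H a n))"
    and H_Suc: "H a (Suc n) = H a n + (if a n then F n (X a n) (H a n) else 0)" for a n
    by (simp_all add: X_def H_def st_def split_beta)
  have generic: "generic_tuple n (X a n)" for a n
  proof (induction n)
    case 0
    then show ?case by (simp add: X_0 generic_tuple_0)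
  next
    case (Suc n)
    then show ?case using YF[OF Suc.IH, of "H a n"] by (cases "a n") (simp_all only: X_Suc if_True if_False)
  qed
  have prefix: "X a n = X b n \<and> H a n = H b n" if "\<forall>i<n. a i = b i" for a b n
    using that by (induction n) (simp_all add: X_0 H_0 X_Suc H_Suc)
  have coordinate: "X a m n = X a (Suc n) n" if "Suc n \<le> m" for a m n
    using that by (induction rule: dec_induct) (simp_all add: X_Suc)
  have increment: "\<exists>f\<in>tuple_stabilizer m (X a m). H a (Suc m) = H a m + f" for a m
    using YF[OF generic] tuple_stabilizer_0 by (auto simp: H_Suc)
  have settled: "conjugate (H a m) (X a (Suc n) n) = conjugate (H a (Suc n)) (X a (Suc n) n)"
    if "Suc n \<le> m" for a m n
    using that
  proof (induction rule: dec_induct)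
    case (step m)
    obtain f where f: "f \<in> tuple_stabilizer m (X a m)" "H a (Suc m) = H a m + f"
      using increment by blast
    have "conjugate f (X a m n) = X a m n"
      using f(1) step(1) by (simp add: tuple_stabilizer_def)
    then have "conjugate f (X a (Suc n) n) = X a (Suc n) n"
      by (simp only: coordinate[OF step(1), of a])
    then show ?case
      using step(3) by (simp add: f(2) conjugate_add)
  qed simp
  have "\<exists>l. H a \<longlonglongrightarrow> l" for a
  proof -
    have "dist (H a n) (H a (Suc n)) \<le> 1 * (1/2) ^ Suc n" for n
      using YF[OF generic, of n a "H a n"] by (simp add: H_Suc)
    then show ?thesis
      using geometric_steps_converge by blast
  qed
  then obtain h where h: "\<And>a. H a \<longlonglongrightarrow> h a" by metis
  have h_conj: "conjugate (h a) (X a (Suc n) n) = conjugate (H a (Suc n)) (X a (Suc n) n)" for a n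
  proof -
    have "(\<lambda>m. conjugate (H a m) (X a (Suc n) n)) \<longlonglongrightarrow> conjugate (h a) (X a (Suc n) n)"
      unfolding conjugate_def by (intro tendsto_intros h)
    moreover have "(\<lambda>m. conjugate (H a m) (X a (Suc n) n)) \<longlonglongrightarrow> conjugate (H a (Suc n)) (X a (Suc n) n)"
      by (rule tendsto_eventually)
        (auto intro!: eventually_sequentiallyI[of "Suc n"] settled)
    ultimately show ?thesis
      by (rule LIMSEQ_unique)
  qed
  have "\<exists>y\<in>A. conjugate (- h b + h a) y \<in> B" if ab: "\<forall>i<n. a i = b i" "\<not> a n" "b n" for a b n
  proof -
    define x g where "x = X a n" and "g = H a n"
    have b: "X b n = x" "H b n = g"
      using prefix[OF ab(1)] by (simp_all add: x_def g_def)
    note yf = YF[OF generic[of n a], of g, folded x_def]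
    have "conjugate (h a) (Y n x g) = conjugate g (Y n x g)"
      using h_conj[of a n] ab(2) by (simp add: X_Suc H_Suc flip: x_def g_def)
    also have "\<dots> = conjugate (g + F n x g) (Y' n x g)"
      using yf by (simp add: conjugate_add)
    also have "\<dots> = conjugate (h b) (Y' n x g)"
      using h_conj[of b n] ab(3) by (simp add: X_Suc H_Suc b)
    finally have "conjugate (- h b + h a) (Y n x g) = Y' n x g"
      by (simp add: conjugate_add)
    then show ?thesis
      using yf by (intro bexI[of _ "Y n x g"]) simp_all
  qed
  then show ?thesis
    by (intro exI[of _ h]) blast
qed

section \<open>Families of translates\<close>

lemma ctwo_cexp_natLeq: "ctwo ^c natLeq =o |UNIV :: (nat \<Rightarrow> bool) set|"
  using card_of_Func_UNIV[of "UNIV :: bool set"]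
  by (simp add: cexp_def ctwo_def Field_natLeq Field_card_of)

text \<open>
  Otherwise the \<open>2\<^sup>\<aleph>\<^sup>0\<close> translates are pairwise disjoint and, since \<open>V\<close> is nonempty, different from each other.
  The uniform Souslin number is at most \<open>2\<^sup>\<aleph>\<^sup>0\<close>, so some of them form a disjoint family of exactly that
  cardinality, contrary to its definition.
\<close>

lemma perfect_family_translates_meet:
  fixes V :: "'h::topological_group_add set" and t :: "(nat \<Rightarrow> bool) \<Rightarrow> 'h"
  assumes S: "uniform_Souslin_number TYPE('h) \<le>o ctwo ^c natLeq" and V: "open V" "V \<noteq> {}"
  shows "\<exists>a b u v. a \<noteq> b \<and> u \<in> V \<and> v \<in> V \<and> u + t a = v + t b"
proof (rule ccontr)
  let ?\<kappa> = "uniform_Souslin_number TYPE('h)"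
  let ?T = "\<lambda>a. (\<lambda>v. v + t a) ` V"
  assume "\<not> ?thesis"
  then have disj: "?T a \<inter> ?T b = {}" if "a \<noteq> b" for a b
    using that by blast
  have "inj ?T"
  proof (rule injI, rule ccontr)
    fix a b assume "?T a = ?T b" "a \<noteq> b"
    then show False using disj[of a b] V(2) by auto
  qed
  then have range: "|UNIV :: (nat \<Rightarrow> bool) set| =o |range ?T|"
    by (intro card_of_ordIsoI[of ?T]) (simp add: bij_betw_def)
  have \<kappa>: "|Field ?\<kappa>| =o ?\<kappa>"
    using uniform_Souslin_number(1) by (rule card_of_Field_ordIso)
  have "|Field ?\<kappa>| \<le>o |range ?T|"
    using ordLeq_ordIso_trans[OF ordIso_ordLeq_trans[OF \<kappa> S] ordIso_transitive[OF ctwo_cexp_natLeq range]] .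
  then obtain f where f: "inj_on f (Field ?\<kappa>)" "f ` Field ?\<kappa> \<subseteq> range ?T"
    using card_of_ordLeq[of "Field ?\<kappa>" "range ?T"] by blast
  have "|Field ?\<kappa>| =o |f ` Field ?\<kappa>|"
    using inj_on_imp_bij_betw[OF f(1)] by (rule card_of_ordIsoI)
  then have "|f ` Field ?\<kappa>| =o ?\<kappa>"
    using ordIso_transitive[OF ordIso_symmetric \<kappa>] by blast
  moreover have "f ` Field ?\<kappa> \<subseteq> right_translates V"
    using f(2) unfolding right_translates_def by blast
  moreover have "disjoint (f ` Field ?\<kappa>)"
  proof (rule disjointI)
    fix P Q assume "P \<in> f ` Field ?\<kappa>" "Q \<in> f ` Field ?\<kappa>" "P \<noteq> Q"
    moreover from this obtain a b where "P = ?T a" "Q = ?T b"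
      using f(2) by (meson imageE subsetD)
    ultimately show "P \<inter> Q = {}"
      using disj[of a b] by auto
  qed
  ultimately show False
    using uniform_Souslin_number(2)[of "TYPE('h)"] V
    unfolding bounds_disjoint_translates_def by metis
qed

text \<open>
  A disjoint family of nonempty open sets injects into a countable dense set.
\<close>

lemma uniform_Souslin_number_separable:
  assumes "separable_space (euclidean :: 'h::topological_group_add topology)"
  shows "uniform_Souslin_number TYPE('h) \<le>o ctwo ^c natLeq"
proof (rule uniform_Souslin_number_least)
  show "Card_order (ctwo ^c natLeq)"
    by (rule Card_order_cexp)
  obtain D :: "'h set" where D: "countable D" "closure D = UNIV"
    using assms by (auto simp: separable_space_def)
  have False if V: "open V" "V \<noteq> {}" and \<F>: "\<F> \<subseteq> right_translates V" "disjoint \<F>"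
      and card: "|\<F>| =o ctwo ^c natLeq" for V :: "'h set" and \<F>
  proof -
    have "\<exists>d. d \<in> S \<inter> D" if S: "S \<in> \<F>" for S
    proof -
      obtain h where h: "S = (\<lambda>v. v + h) ` V"
        using S \<F>(1) unfolding right_translates_def by blast
      have "open S"
        using V(1) homeomorphic_imp_open_map[OF homeomorphic_map_translations(1)[of 0 h]]
        by (simp add: h open_map_def)
      then show ?thesis
        using open_Int_closure_eq_empty[of S D] V(2) D(2) h by blast
    qed
    then obtain d where d: "\<And>S. S \<in> \<F> \<Longrightarrow> d S \<in> S \<inter> D" by metis
    have "inj_on d \<F>"
    proof (rule inj_onI, rule ccontr)
      fix P Q assume "P \<in> \<F>" "Q \<in> \<F>" "d P = d Q" "P \<noteq> Q"
      then show False
        using d[of P] d[of Q] \<F>(2) by (auto simp: disjoint_def)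
    qed
    moreover have "countable (d ` \<F>)"
      by (rule countable_subset[OF _ D(1)]) (use d in auto)
    ultimately have "countable \<F>"
      by (auto dest: countable_image_inj_on)
    then have "|\<F>| \<le>o natLeq"
      by (simp add: countable_card_le_natLeq)
    also have "natLeq <o ctwo ^c natLeq"
      by (intro ordLess_ctwo_cexp natLeq_Card_order)
    finally show False
      using card not_ordLess_ordIso by blast
  qed
  then show "bounds_disjoint_translates TYPE('h) (ctwo ^c natLeq)"
    unfolding bounds_disjoint_translates_def by blast
qed

section \<open>Automatic continuity\<close>

locale Souslin_homomorphism =
  fixes \<pi> :: "'g::{polish_space, topological_group_add} \<Rightarrow> 'h::topological_group_add"
  assumes hom: "\<pi> (x + y) = \<pi> x + \<pi> y"
    and Souslin: "uniform_Souslin_number TYPE('h) \<le>o ctwo ^c natLeq"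
begin

lemma hom_0 [simp]: "\<pi> 0 = 0"
proof -
  have "\<pi> 0 + \<pi> 0 = \<pi> 0 + 0"
    using hom[of 0 0] by simp
  then show ?thesis
    by (simp only: add_left_cancel)
qed

lemma hom_minus: "\<pi> (- x) = - \<pi> x"
  using hom[of "- x" x] by (simp add: eq_neg_iff_add_eq_0)

text \<open>
  If \<open>V + t a\<close> and \<open>V + t b\<close> meet, then \<open>t a - t b\<close> is in \<open>- V + V\<close>; this is applied to the images of a
  family whose differences avoid the preimage of \<open>W\<close>.
\<close>

lemma preimage_nhd_not_meager:
  assumes "open W" "0 \<in> W"
  shows "\<not> meager_in euclidean (\<pi> -` W)"
proof
  assume "meager_in euclidean (\<pi> -` W)"
  then obtain h :: "(nat \<Rightarrow> bool) \<Rightarrow> 'g" where h: "\<And>a b. a \<noteq> b \<Longrightarrow> h a - h b \<notin> \<pi> -` W"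
    using perfect_family_avoiding_meager_differences[of "\<pi> -` W"] assms(2) by auto
  obtain V where V: "open V" "0 \<in> V" "\<And>x. x \<in> V \<Longrightarrow> - x \<in> V"
    "\<And>x y. x \<in> V \<Longrightarrow> y \<in> V \<Longrightarrow> x + y \<in> W"
    using symmetric_halving[OF assms] by blast
  obtain a b u v where ab: "a \<noteq> b" "u \<in> V" "v \<in> V" "u + \<pi> (h a) = v + \<pi> (h b)"
    using perfect_family_translates_meet[OF Souslin V(1), of "\<lambda>a. \<pi> (h a)"] V(2) by blast
  have "\<pi> (h a - h b) = - u + (u + \<pi> (h a)) - \<pi> (h b)"
    by (simp add: hom hom_minus diff_conv_add_uminus add.assoc del: add_uminus_conv_diff)
  also have "\<dots> = - u + v"
    by (simp add: ab(4) diff_conv_add_uminus add.assoc del: add_uminus_conv_diff)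
  finally show False
    using h[OF ab(1)] V(3,4) ab(2,3) by auto
qed

end

locale ample_Souslin_homomorphism = Souslin_homomorphism \<pi>
  for \<pi> :: "'g::{polish_space, topological_group_add} \<Rightarrow> 'h::topological_group_add" +
  assumes ample: "ample_generic_elements TYPE('g)"
begin

text \<open>
  The family obtained from ample generics yields elements conjugating a point with small image to one
  with large image, whereas two of the translates of \<open>V\<close> by the negatives \<open>- \<pi> (h a)\<close> meet. The
  negatives are needed because right translates by \<open>- \<pi> (h a)\<close> and \<open>- \<pi> (h b)\<close> compare the left quotient \<open>- h a + h b\<close>,
  and this is the element by which \<open>h\<close> conjugates.
\<close>

lemma preimage_nhd_somewhere_comeager:
  assumes "open W" "0 \<in> W"
  shows "\<exists>U. open U \<and> U \<noteq> {} \<and> meager_in euclidean (- (\<pi> -` W) \<inter> U)"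
proof (rule ccontr)
  assume "\<not> ?thesis"
  then have B: "\<not> meager_in euclidean (- (\<pi> -` W) \<inter> U)" if "open U" "U \<noteq> {}" for U
    using that by blast
  obtain W2 where W2: "open W2" "0 \<in> W2" "\<And>x. x \<in> W2 \<Longrightarrow> - x \<in> W2"
    "\<And>x y. x \<in> W2 \<Longrightarrow> y \<in> W2 \<Longrightarrow> x + y \<in> W"
    using symmetric_halving[OF assms] by blast
  obtain W3 where W3: "open W3" "0 \<in> W3" "\<And>x. x \<in> W3 \<Longrightarrow> - x \<in> W3"
    "\<And>x y. x \<in> W3 \<Longrightarrow> y \<in> W3 \<Longrightarrow> x + y \<in> W2"
    using symmetric_halving[OF W2(1,2)] by blast
  obtain V where V: "open V" "0 \<in> V" "\<And>x. x \<in> V \<Longrightarrow> - x \<in> V"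
    "\<And>x y. x \<in> V \<Longrightarrow> y \<in> V \<Longrightarrow> x + y \<in> W3"
    using symmetric_halving[OF W3(1,2)] by blast
  obtain h :: "(nat \<Rightarrow> bool) \<Rightarrow> 'g" where h: "\<And>a b n. \<forall>i<n. a i = b i \<Longrightarrow> \<not> a n \<Longrightarrow> b n \<Longrightarrow>
      \<exists>y\<in>\<pi> -` W3. conjugate (- h b + h a) y \<in> - (\<pi> -` W)"
    using perfect_family_conjugating[OF ample preimage_nhd_not_meager[OF W3(1,2)] B] by blast
  obtain a b u v where ab: "a \<noteq> b" "u \<in> V" "v \<in> V" "u + - \<pi> (h a) = v + - \<pi> (h b)"
    using perfect_family_translates_meet[OF Souslin V(1), of "\<lambda>a. - \<pi> (h a)"] V(2) by blast
  have "\<pi> (- h a + h b) = - u + (u + - \<pi> (h a)) + \<pi> (h b)"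
    by (simp add: hom hom_minus add.assoc diff_conv_add_uminus del: add_uminus_conv_diff)
  also have "\<dots> = - u + v"
    unfolding ab(4) by (simp add: add.assoc diff_conv_add_uminus del: add_uminus_conv_diff)
  finally have ab_W3: "\<pi> (- h a + h b) \<in> W3"
    using V(3,4) ab(2,3) by auto
  have "- (- h a + h b) = - h b + h a"
    by (simp add: minus_add)
  then have ba_W3: "\<pi> (- h b + h a) \<in> W3"
    using W3(3)[OF ab_W3] by (simp only: hom_minus[symmetric])
  \<comment> \<open>\<open>\<pi> c + \<pi> y - \<pi> c\<close> is a sum of three elements of \<open>W3\<close>.\<close>
  have small: "conjugate c y \<in> \<pi> -` W" if "\<pi> c \<in> W3" "\<pi> y \<in> W3" for c y
  proof -
    have "\<pi> c + \<pi> y \<in> W2" "- \<pi> c + 0 \<in> W2"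
      using that W3(2,3,4) by blast+
    then show ?thesis
      using W2(4)[of "\<pi> c + \<pi> y" "- \<pi> c"]
      by (simp add: conjugate_def hom hom_minus diff_conv_add_uminus del: add_uminus_conv_diff)
  qed
  have "\<exists>n. a n \<noteq> b n"
    using ab(1) by blast
  then obtain n where n: "a n \<noteq> b n" and prefix: "\<forall>i<n. a i = b i"
    using exists_least_iff[of "\<lambda>n. a n \<noteq> b n"] by blast
  have no_escape: "\<not> (\<exists>y\<in>\<pi> -` W3. conjugate c y \<in> - (\<pi> -` W))" if "\<pi> c \<in> W3" for c
    using small[OF that] by blast
  show False
  proof (cases "a n")
    case True
    then have "\<not> b n" "\<forall>i<n. b i = a i"
      using n prefix by auto
    then show False
      using h[of n b a] True no_escape[OF ab_W3] by blast
  next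
    case False
    then have "b n"
      using n by auto
    then show False
      using h[of n a b] prefix False no_escape[OF ba_W3] by blast
  qed
qed

text \<open>
  Pettis's argument: if \<open>\<pi> -` V\<close> is comeager in the open set \<open>U\<close> and \<open>g\<close> is small, then \<open>U\<close> and its translate by
  \<open>- g\<close> overlap in a nonempty open set. Some \<open>x\<close> there has both \<open>x\<close> and \<open>g + x\<close> in \<open>\<pi> -` V\<close>.
\<close>

lemma preimage_nhd:
  assumes "open W" "0 \<in> W"
  shows "\<exists>N. open N \<and> 0 \<in> N \<and> \<pi> ` N \<subseteq> W"
proof -
  obtain V where V: "open V" "0 \<in> V" "\<And>x. x \<in> V \<Longrightarrow> - x \<in> V"
    "\<And>x y. x \<in> V \<Longrightarrow> y \<in> V \<Longrightarrow> x + y \<in> W"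
    using symmetric_halving[OF assms] by blast
  obtain U where U: "open U" "U \<noteq> {}" "meager_in euclidean (- (\<pi> -` V) \<inter> U)"
    using preimage_nhd_somewhere_comeager[OF V(1,2)] by blast
  let ?M = "- (\<pi> -` V) \<inter> U"
  obtain u where u: "u \<in> U" using U(2) by blast
  let ?N = "(\<lambda>g. g + u) -` U"
  have "\<pi> g \<in> W" if g: "g \<in> ?N" for g
  proof -
    have "open (U \<inter> (\<lambda>x. g + x) -` U)"
      using U(1) by (intro open_Int open_vimage continuous_intros)
    moreover have "u \<in> U \<inter> (\<lambda>x. g + x) -` U"
      using u g by simp
    ultimately have "\<not> meager_in euclidean (U \<inter> (\<lambda>x. g + x) -` U)"
      by (intro nonempty_open_not_meager_in completely_metrizable_space_euclidean) auto
    moreover have "meager_in euclidean (?M \<union> (\<lambda>x. - g + x + 0) ` ?M)"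
      using meager_in_homeomorphic_image[OF homeomorphic_map_translations(1) U(3)] U(3)
      by (intro meager_in_Un)
    ultimately have "\<not> U \<inter> (\<lambda>x. g + x) -` U \<subseteq> ?M \<union> (\<lambda>x. - g + x + 0) ` ?M"
      by (meson meager_in_subset)
    then obtain x where x: "x \<in> U" "g + x \<in> U" "x \<notin> ?M" "x \<notin> (\<lambda>x. - g + x + 0) ` ?M"
      by blast
    have "g + x \<notin> ?M"
    proof
      assume "g + x \<in> ?M"
      then have "- g + (g + x) + 0 \<in> (\<lambda>x. - g + x + 0) ` ?M" by blast
      then show False using x(4) by simp
    qed
    then have "\<pi> (g + x) \<in> V" "- \<pi> x \<in> V"
      using x V(3) by auto
    then have "\<pi> (g + x) + - \<pi> x \<in> W"
      by (rule V(4))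
    then show ?thesis
      by (simp add: hom add.assoc)
  qed
  moreover have "open ?N"
    using U(1) by (intro open_vimage continuous_intros)
  ultimately show ?thesis
    using u by (intro exI[of _ ?N]) auto
qed

lemma continuous: "continuous_on UNIV \<pi>"
  unfolding continuous_on_topological
proof (intro ballI allI impI)
  fix x W assume W: "open W" "\<pi> x \<in> W"
  have "open ((\<lambda>y. y + \<pi> x) -` W)"
    using W(1) by (intro open_vimage continuous_intros)
  then obtain N where N: "open N" "0 \<in> N" "\<pi> ` N \<subseteq> (\<lambda>y. y + \<pi> x) -` W"
    using preimage_nhd[of "(\<lambda>y. y + \<pi> x) -` W"] W(2) by auto
  have "open ((\<lambda>g. g - x) -` N)"
    using N(1) by (intro open_vimage continuous_intros)
  moreover have "\<pi> g \<in> W" if "g - x \<in> N" for g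
    using N(3) that hom[of "g - x" x] by auto
  ultimately show "\<exists>A. open A \<and> x \<in> A \<and> (\<forall>y\<in>UNIV. y \<in> A \<longrightarrow> \<pi> y \<in> W)"
    using N(2) by (intro exI[of _ "(\<lambda>g. g - x) -` N"]) auto
qed

end

theorem theorem1p10:
  fixes \<pi> :: "'g::{polish_space, topological_group_add} \<Rightarrow> 'h::topological_group_add"
  shows "(ample_generic_elements TYPE('g) \<and> (\<forall>x y. \<pi> (x + y) = \<pi> x + \<pi> y) \<and>
            uniform_Souslin_number TYPE('h) \<le>o ctwo ^c natLeq
            \<longrightarrow> continuous_on UNIV \<pi>) \<and>
         (separable_space (euclidean :: 'h topology)
            \<longrightarrow> uniform_Souslin_number TYPE('h) \<le>o ctwo ^c natLeq)"
proof (intro conjI impI)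
  assume *: "ample_generic_elements TYPE('g) \<and> (\<forall>x y. \<pi> (x + y) = \<pi> x + \<pi> y) \<and>
      uniform_Souslin_number TYPE('h) \<le>o ctwo ^c natLeq"
  then interpret ample_Souslin_homomorphism \<pi>
    by unfold_locales auto
  show "continuous_on UNIV \<pi>"
    by (rule continuous)
qed (rule uniform_Souslin_number_separable)

end
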